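(* For any fixed $\epsilon>0$, $$F_n\!\left(e^{\frac{n^{1-\epsilon}}{2}}\right)\to 0\qquad\text{and}\qquad F_n\!\left(e^{\frac{n^{1+\epsilon}}{2}}\right)\to 1\qquad\text{as } n\to\infty.$$
   Context: Let $a_0,a_1,a_2,\dots$ be i.i.d. complex random variables with density $\frac1\pi e^{-|z|^2}$ with respect to Lebesgue measure on $\mathbb{C}$. For an integer $n\ge 2$, the Gaussian $SU(2)$ random polynomial is $p_n(z)=\sum_{j=0}^n a_j\sqrt{\binom nj}\,z^j$, $z\in\mathbb{C}$. The expected density $\mathbb{D}_{|p_n|}$ of the nonvanishing critical values of $|p_n|$ is the (continuous) function on $\mathbb{R}_+=[0,\infty)$ such that for every $\phi\in C_c^\infty(\mathbb{R}_+)$, $$\mathbb{E}\sum_{z\in\mathbb{C}:\,p_n'(z)=0}\phi(|p_n(z)|)=\int_0^\infty\phi(x)\,\mathbb{D}_{|p_n|}(x)\,dx.$$ $F_n$ denotes the distribution function of the probability density $\frac{\mathbb{D}_{|p_n|}}{n-1}$, i.e. $F_n(x)=\frac{1}{n-1}\int_0^x\mathbb{D}_{|p_n|}(y)\,dy$ for $x\ge 0$. *)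

theory Defs
  imports "HOL-Probability.Probability" "HOL-Computational_Algebra.Polynomial"
begin

definition su2_poly :: "(nat \<Rightarrow> complex) \<Rightarrow> nat \<Rightarrow> complex poly" where
  "su2_poly c n = (\<Sum>j\<le>n. monom (c j * complex_of_real (sqrt (real (n choose j)))) j)"

(* Real-valued C_c^infinity([0,\<infinity>)): smooth up to the boundary point 0 (one-sided derivatives there),
   and not required to vanish near 0. Values at negative arguments are irrelevant. *)
definition test_function :: "(real \<Rightarrow> real) \<Rightarrow> bool" where
  "test_function \<phi> \<longleftrightarrow>
     (\<exists>g :: nat \<Rightarrow> real \<Rightarrow> real. g 0 = \<phi> \<and>
        (\<forall>k. \<forall>x\<ge>0. (g k has_real_derivative g (Suc k) x) (at x within {0..}))) \<and>
     compact (closure {x \<in> {0..}. \<phi> x \<noteq> 0})"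

(* If the derivative is the zero polynomial, the sum below is 0 because its index set is infinite.
   For Gaussian coefficients and n \<ge> 2 this, and the occurrence of multiple critical points, are null events. *)
definition critical_value_sum :: "complex poly \<Rightarrow> (real \<Rightarrow> real) \<Rightarrow> real" where
  "critical_value_sum p \<phi> = (\<Sum>z | poly (pderiv p) z = 0. \<phi> (cmod (poly p z)))"

(* D is determined on [0,\<infinity>) only. *)
definition is_expected_density ::
    "'a measure \<Rightarrow> (nat \<Rightarrow> 'a \<Rightarrow> complex) \<Rightarrow> nat \<Rightarrow> (real \<Rightarrow> real) \<Rightarrow> bool" where
  "is_expected_density M a n D \<longleftrightarrow>
     continuous_on {0..} D \<and>
     (\<forall>\<phi>. test_function \<phi> \<longrightarrow>
        has_bochner_integral M (\<lambda>\<omega>. critical_value_sum (su2_poly (\<lambda>j. a j \<omega>) n) \<phi>)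
          (LBINT x:{0..}. \<phi> x * D x))"

definition critical_value_cdf :: "nat \<Rightarrow> (real \<Rightarrow> real) \<Rightarrow> real \<Rightarrow> real" where
  "critical_value_cdf n D x = 1 / (real n - 1) * (LBINT y:{0..x}. D y)"

end

theory Submission
  imports Defs
    "HOL-Computational_Algebra.Fundamental_Theorem_Algebra"
    "HOL-Complex_Analysis.Conformal_Mappings"
    "HOL-Real_Asymp.Real_Asymp"
begin

text \<open>
  No formula for the density is needed; everything follows from bounds on numbers of critical points
  that hold with high probability. A Jensen-type estimate for $p_n'$, whose extreme coefficients are
  rarely tiny, shows that for small \<open>\<delta>\<close> only a small proportion of the critical points lies outside the
  annulus $\delta \le |z| \le 1/\delta$. Inside the annulus $|p_n(z)| \le e^{Cn}$, which settles the upper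
  threshold, because almost surely there are \<open>n - 1\<close> distinct critical points. For the lower threshold,
  a critical point with $|p_n(z)|$ exponentially smaller than its typical size $(1+|z|^2)^{n/2}$
  forces both $p_n$ and $p_n'$ to be small on a surrounding disc of radius $n^{-6}$; since the pair
  $(p_n(z), p_n'(z))$ has a bounded density on the scale $(1+|z|^2)^{n/2}$, the expected area of the set where
  this happens is too small. Finally, $F_n(x)$ is a limit of expectations of smooth cutoffs of
  the indicator function of $[0,x]$.
\<close>

subsection \<open>Roots of a polynomial outside an annulus\<close>

text \<open>Since n^(1-\<epsilon>) = o(n) and n = o(n^(1+\<epsilon>)), it is enough to place all but
  a small proportion of the critical values between e^(cn) and e^(Cn), where c and C may depend on
  that proportion. So the annulus is fixed before n grows. The obstacle at the lower threshold is
  that a critical point is random, whereas probabilities are available only at fixed points. The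
  disc trades one for the other by Markov's inequality for an area, at the price of dividing by
  \<eta>^2. This pays because the pair (p_n, p_n') is two-dimensional over the complex numbers: on
  the disc p_n' is of size \<eta> and p_n of size \<eta>^2 relative to the weight, which has
  probability of order \<eta>^2 * \<eta>^4 up to powers of n. A factor \<eta>^4 survives and beats
  these powers for \<eta> = n^(-6).\<close>

lemma cmod_poly_0_le_prod_roots:
  fixes f :: "complex poly"
  assumes "finite A" and "\<And>w. w \<in> A \<Longrightarrow> poly f w = 0 \<and> cmod w < 1"
    and "\<And>z. cmod z = 1 \<Longrightarrow> cmod (poly f z) \<le> L"
  shows "cmod (poly f 0) \<le> L * (\<Prod>w\<in>A. cmod w)"
  using assms
proof (induction A arbitrary: f rule: finite_induct)
  case empty
  have "cmod (poly f 0) \<le> L"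
  proof (rule maximum_modulus_frontier[of "poly f" "ball 0 1"])
    show "poly f holomorphic_on interior (ball 0 1)" by (intro holomorphic_intros)
    show "continuous_on (closure (ball 0 1)) (poly f)" by (intro continuous_intros)
    show "cmod (poly f z) \<le> L" if "z \<in> frontier (ball 0 1)" for z
      using that empty by (simp add: frontier_def dist_norm)
  qed auto
  then show ?case by simp
next
  case (insert w A)
  obtain g where g: "f = [:- w, 1:] * g"
    using insert.prems(1)[of w] by (auto simp: poly_eq_0_iff_dvd elim!: dvdE)
  \<comment> \<open>Blaschke factor: |z - w| = |1 - cnj w * z| on the unit circle, so trading one
    for the other keeps the bound \<open>L\<close>, while at 0 the modulus of the factor changes
    from |w| to 1. This releases one factor of the product.\<close>
  define h where "h = [:1, - cnj w:] * g"
  have "cmod (poly h 0) \<le> L * (\<Prod>w\<in>A. cmod w)"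
  proof (rule insert.IH)
    show "poly h v = 0 \<and> cmod v < 1" if "v \<in> A" for v
      using insert.prems(1)[of v] insert.hyps(2) that by (auto simp: g h_def)
    show "cmod (poly h z) \<le> L" if z: "cmod z = 1" for z
    proof -
      have "z * cnj z = 1" using z by (simp add: complex_norm_square[symmetric])
      then have "1 - z * cnj w = z * cnj (z - w)" by (simp add: algebra_simps)
      then have "cmod (1 - z * cnj w) = cmod (z - w)"
        using z by (simp add: norm_mult del: complex_cnj_diff)
      moreover have "poly h z = (1 - z * cnj w) * poly g z" "poly f z = (z - w) * poly g z"
        by (simp_all add: h_def g algebra_simps)
      ultimately have "cmod (poly h z) = cmod (poly f z)" by (simp add: norm_mult)
      then show ?thesis using insert.prems(2)[OF z] by simp
    qed
  qed
  then have "cmod w * cmod (poly h 0) \<le> cmod w * (L * (\<Prod>w\<in>A. cmod w))"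
    by (intro mult_left_mono) auto
  moreover have "cmod (poly f 0) = cmod w * cmod (poly h 0)" by (simp add: g h_def norm_mult)
  ultimately show ?case using insert.hyps by (simp add: mult_ac)
qed

text \<open>Jensen's inequality in counting form: every root of modulus below \<delta> costs a
  factor \<delta>, so a value at 0 that is not tiny compared with \<open>L\<close> leaves room for
  few of them.\<close>

lemma card_roots_near_0:
  fixes f :: "complex poly"
  assumes "f \<noteq> 0" "0 < \<delta>" "\<delta> \<le> 1" and bd: "\<And>z. cmod z = 1 \<Longrightarrow> cmod (poly f z) \<le> L"
  shows "cmod (poly f 0) \<le> L * \<delta> ^ card {z. poly f z = 0 \<and> cmod z < \<delta>}"
proof -
  let ?A = "{z. poly f z = 0 \<and> cmod z < \<delta>}"
  have fin: "finite ?A" using poly_roots_finite[OF assms(1)] by (rule rev_finite_subset) auto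
  have "cmod (poly f 0) \<le> L * (\<Prod>w\<in>?A. cmod w)"
    using assms by (intro cmod_poly_0_le_prod_roots fin) auto
  also have "\<dots> \<le> L * \<delta> ^ card ?A"
  proof (rule mult_left_mono)
    have "(\<Prod>w\<in>?A. cmod w) \<le> (\<Prod>w\<in>?A. \<delta>)" by (intro prod_mono) auto
    then show "(\<Prod>w\<in>?A. cmod w) \<le> \<delta> ^ card ?A" by simp
    show "0 \<le> L" by (rule order_trans[OF norm_ge_zero bd[of 1]]) simp
  qed
  finally show ?thesis .
qed

text \<open>Inversion reduces this to roots near 0: the reversed polynomial has the reciprocals of
  the nonzero roots, the constant coefficient \<open>lead_coeff f\<close>, and the same bound on the
  unit circle.\<close>

lemma card_roots_near_infinity:
  fixes f :: "complex poly"
  assumes "f \<noteq> 0" "0 < \<delta>" "\<delta> \<le> 1" and bd: "\<And>z. cmod z = 1 \<Longrightarrow> cmod (poly f z) \<le> L"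
  shows "cmod (lead_coeff f) \<le> L * \<delta> ^ card {z. poly f z = 0 \<and> cmod z > 1 / \<delta>}"
proof -
  let ?g = "reflect_poly f"
  let ?A = "{z. poly f z = 0 \<and> cmod z > 1 / \<delta>}" and ?B = "{z. poly ?g z = 0 \<and> cmod z < \<delta>}"
  have g0: "?g \<noteq> 0" using assms(1) by simp
  have L0: "0 \<le> L" by (rule order_trans[OF norm_ge_zero bd[of 1]]) simp
  have "cmod (poly ?g 0) \<le> L * \<delta> ^ card ?B"
  proof (rule card_roots_near_0[OF g0 assms(2,3)])
    show "cmod (poly ?g z) \<le> L" if "cmod z = 1" for z
    proof -
      have "z \<noteq> 0" using that by auto
      then show ?thesis using bd[of "inverse z"] that
        by (simp add: poly_reflect_poly_nz norm_mult norm_power norm_inverse)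
    qed
  qed
  also have "\<dots> \<le> L * \<delta> ^ card ?A"
  proof (intro mult_left_mono L0 power_decreasing)
    have "inverse ` ?A \<subseteq> ?B"
    proof safe
      fix z assume z: "poly f z = 0" "1 / \<delta> < cmod z"
      have "0 < 1 / \<delta>" using assms by simp
      then have "z \<noteq> 0" using z by auto
      then show "poly ?g (inverse z) = 0" using z by (simp add: poly_reflect_poly_nz)
      show "cmod (inverse z) < \<delta>" using z assms \<open>z \<noteq> 0\<close>
        by (simp add: norm_inverse norm_divide field_simps)
    qed
    moreover have "finite ?B" using poly_roots_finite[OF g0] by (rule rev_finite_subset) auto
    ultimately have "card (inverse ` ?A) \<le> card ?B" by (rule card_mono[rotated])
    then show "card ?A \<le> card ?B" by (simp add: card_image inj_on_def)
  qed (use assms in auto)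
  finally show ?thesis by simp
qed

subsection \<open>Deterministic estimates for critical points\<close>

abbreviation su2_weight :: "nat \<Rightarrow> nat \<Rightarrow> real" where
  "su2_weight n j \<equiv> sqrt (real (n choose j))"

lemma poly_su2_poly:
  fixes c :: "nat \<Rightarrow> complex" and z :: complex
  shows "poly (su2_poly c n) z = (\<Sum>j\<le>n. c j * (su2_weight n j * z ^ j))"
  by (simp add: su2_poly_def poly_sum poly_monom mult_ac)

lemma coeff_su2_poly:
  fixes c :: "nat \<Rightarrow> complex"
  shows "coeff (su2_poly c n) j = (if j \<le> n then c j * su2_weight n j else 0)"
  by (simp add: su2_poly_def coeff_sum coeff_monom)

lemma pderiv_sum: "pderiv (\<Sum>i\<in>A. f i) = (\<Sum>i\<in>A. pderiv (f i))"
  by (induction A rule: infinite_finite_induct) (auto simp: pderiv_add)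

lemma poly_pderiv_su2_poly:
  fixes c :: "nat \<Rightarrow> complex" and z :: complex
  shows "poly (pderiv (su2_poly c n)) z = (\<Sum>j\<le>n. c j * (of_nat j * su2_weight n j * z ^ (j - 1)))"
  by (simp add: su2_poly_def pderiv_sum pderiv_monom poly_sum poly_monom mult_ac)

lemma poly_pderiv_pderiv_su2_poly:
  fixes c :: "nat \<Rightarrow> complex" and z :: complex
  shows "poly (pderiv (pderiv (su2_poly c n))) z =
     (\<Sum>j\<le>n. c j * (of_nat j * of_nat (j - 1) * su2_weight n j * z ^ (j - 2)))"
  by (simp add: su2_poly_def pderiv_sum pderiv_monom poly_sum poly_monom mult_ac diff_diff_left numeral_2_eq_2)

text \<open>The standard deviation of p_n(z): the variances of the terms add up to (1 + |z|^2)^n by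
  the binomial theorem. Smallness of the polynomial and of its derivative is measured relative to
  it.\<close>

definition fs_weight :: "nat \<Rightarrow> complex \<Rightarrow> real" where
  "fs_weight n z = sqrt ((1 + (cmod z)\<^sup>2) ^ n)"

lemma fs_weight_pos [simp]: "fs_weight n z > 0"
  by (simp add: fs_weight_def add_pos_nonneg)

lemma fs_weight_nonneg [simp]: "fs_weight n z \<ge> 0"
  by (rule less_imp_le) simp

lemma su2_weight_mult_power_le: "su2_weight n j * cmod z ^ j \<le> fs_weight n z"
proof (cases "j \<le> n")
  case True
  have "(su2_weight n j * cmod z ^ j)\<^sup>2 = real (n choose j) * ((cmod z)\<^sup>2) ^ j"
    by (simp add: power_mult_distrib flip: power_mult) (simp add: mult.commute)
  also have "\<dots> \<le> (\<Sum>k\<le>n. real (n choose k) * ((cmod z)\<^sup>2) ^ k)"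
    using True by (intro member_le_sum) auto
  also have "\<dots> = (1 + (cmod z)\<^sup>2) ^ n"
    using binomial_ring[of "(cmod z)\<^sup>2" "1::real" n] by (simp add: add.commute)
  finally show ?thesis unfolding fs_weight_def by (rule real_le_rsqrt)
qed (simp add: binomial_eq_0 less_imp_le)

lemma su2_weight_le: "su2_weight n j \<le> 2 ^ n"
proof (rule real_le_lsqrt)
  have "real (n choose j) \<le> 2 ^ n" using binomial_le_pow2[of n j]
    by (metis of_nat_le_iff of_nat_numeral of_nat_power)
  also have "\<dots> \<le> (2 ^ n)\<^sup>2" by (simp add: power2_eq_square)
  finally show "real (n choose j) \<le> (2 ^ n)\<^sup>2" .
qed auto

text \<open>The indices 1 and n are singled out because p_n' has the value
  \<open>c 1 * sqrt n\<close> at 0 and the leading coefficient \<open>n * c n\<close>, which limit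
  the roots near 0 and near infinity. The bounds n and 1/n are loose enough to hold with probability
  tending to 1.\<close>

definition tame_coeffs :: "(nat \<Rightarrow> complex) \<Rightarrow> nat \<Rightarrow> bool" where
  "tame_coeffs c n \<longleftrightarrow> (\<forall>j\<le>n. cmod (c j) \<le> n) \<and> 1 / n \<le> cmod (c 1) \<and> 1 / n \<le> cmod (c n)"

lemma cmod_sum_le_card:
  assumes "\<And>j. j \<le> n \<Longrightarrow> cmod (f j) \<le> B"
  shows "cmod (\<Sum>j\<le>n. f j) \<le> (real n + 1) * B"
  using sum_norm_bound[of "{..n}" f B] assms by (simp add: add.commute)

lemma cmod_poly_su2_poly_le:
  assumes "\<forall>j\<le>n. cmod (c j) \<le> n"
  shows "cmod (poly (su2_poly c n) z) \<le> (real n + 1) * (n * fs_weight n z)"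
  unfolding poly_su2_poly
proof (rule cmod_sum_le_card)
  fix j assume "j \<le> n"
  then have "cmod (c j) * (su2_weight n j * cmod z ^ j) \<le> n * fs_weight n z"
    using assms by (intro mult_mono su2_weight_mult_power_le) auto
  then show "cmod (c j * (su2_weight n j * z ^ j)) \<le> n * fs_weight n z"
    by (simp add: norm_mult norm_power)
qed

lemma cmod_pderiv_su2_poly_unit_circle_le:
  assumes "\<forall>j\<le>n. cmod (c j) \<le> n" "cmod z = 1"
  shows "cmod (poly (pderiv (su2_poly c n)) z) \<le> (real n + 1) * (real n * (real n * 2 ^ n))"
  unfolding poly_pderiv_su2_poly
proof (rule cmod_sum_le_card)
  fix j assume "j \<le> n"
  then have "cmod (c j) * (j * su2_weight n j) \<le> real n * (real n * 2 ^ n)"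
    using assms by (intro mult_mono su2_weight_le) auto
  then show "cmod (c j * (of_nat j * su2_weight n j * z ^ (j - 1))) \<le> real n * (real n * 2 ^ n)"
    using assms by (simp add: norm_mult norm_power)
qed

lemma poly_pderiv_su2_poly_0:
  assumes "n \<ge> 1"
  shows "poly (pderiv (su2_poly c n)) 0 = c 1 * su2_weight n 1"
proof -
  have "poly (pderiv (su2_poly c n)) 0 = coeff (pderiv (su2_poly c n)) 0"
    by (simp add: poly_0_coeff_0)
  then show ?thesis using assms by (simp add: coeff_pderiv coeff_su2_poly)
qed

lemma degree_pderiv_su2_poly:
  assumes "n \<ge> 1" "c n \<noteq> 0"
  shows "degree (pderiv (su2_poly c n)) = n - 1"
    and "lead_coeff (pderiv (su2_poly c n)) = of_nat n * c n"
    and "pderiv (su2_poly c n) \<noteq> 0"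
proof -
  have "degree (su2_poly c n) = n"
  proof (rule antisym)
    show "degree (su2_poly c n) \<le> n"
      by (rule degree_le) (simp add: coeff_su2_poly)
    show "n \<le> degree (su2_poly c n)"
      by (rule le_degree) (simp add: coeff_su2_poly assms)
  qed
  then show d: "degree (pderiv (su2_poly c n)) = n - 1" by (simp add: degree_pderiv)
  show l: "lead_coeff (pderiv (su2_poly c n)) = of_nat n * c n"
    using assms unfolding d by (simp add: coeff_pderiv coeff_su2_poly)
  show "pderiv (su2_poly c n) \<noteq> 0" using l assms by auto
qed

lemma card_critical_points_le:
  fixes c :: "nat \<Rightarrow> complex"
  shows "card {z. poly (pderiv (su2_poly c n)) z = 0} \<le> n - 1"
proof (cases "pderiv (su2_poly c n) = 0")
  case False
  have "degree (su2_poly c n) \<le> n" by (rule degree_le) (simp add: coeff_su2_poly)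
  then show ?thesis using card_poly_roots_bound[OF False] by (simp add: degree_pderiv)
qed (use infinite_UNIV_char_0[where 'a=complex] in auto)

text \<open>The 5 counts the factors \<open>n\<close>, \<open>n + 1\<close>, \<open>n\<close>,
  \<open>n\<close>, \<open>2 ^ n\<close> present after clearing the denominator, each of them at
  most \<open>exp n\<close>.\<close>

lemma card_mult_ln_le:
  fixes k n :: nat
  assumes n: "n \<ge> 1" and d: "0 < \<delta>" and le: "1 / n \<le> (real n + 1) * (real n * (real n * 2 ^ n)) * \<delta> ^ k"
  shows "k * ln (1 / \<delta>) \<le> 5 * real n"
proof -
  have e: "real n \<le> exp n" "real n + 1 \<le> exp n" "(2::real) ^ n \<le> exp n"
  proof -
    show "real n + 1 \<le> exp n" using exp_ge_add_one_self[of "real n"] by linarith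
    then show "real n \<le> exp n" by linarith
    have "(2::real) ^ n \<le> exp 1 ^ n" using exp_ge_add_one_self[of "1::real"] by (intro power_mono) auto
    then show "(2::real) ^ n \<le> exp n" by (simp add: exp_of_nat_mult[symmetric])
  qed
  have "(1 / \<delta>) ^ k \<le> n * ((real n + 1) * (real n * (real n * 2 ^ n)))"
    using le n d by (simp add: field_simps)
  also have "\<dots> \<le> exp n * (exp n * (exp n * (exp n * exp n)))"
    by (intro mult_mono e mult_nonneg_nonneg) auto
  also have "\<dots> = exp (5 * n)" by (simp add: mult_exp_exp)
  finally have "ln ((1 / \<delta>) ^ k) \<le> ln (exp (5 * real n))"
    using d by (subst ln_le_cancel_iff) auto
  then show ?thesis using d by (simp add: ln_realpow)
qed

lemma card_critical_points_outside_annulus: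
  assumes n: "n \<ge> 2" and c: "tame_coeffs c n" and d: "0 < \<delta>" "\<delta> \<le> 1"
  shows "card {z. poly (pderiv (su2_poly c n)) z = 0 \<and> cmod z < \<delta>} * ln (1 / \<delta>) \<le> 5 * real n" (is ?near0)
    and "card {z. poly (pderiv (su2_poly c n)) z = 0 \<and> cmod z > 1 / \<delta>} * ln (1 / \<delta>) \<le> 5 * real n" (is ?near_inf)
proof -
  let ?f = "pderiv (su2_poly c n)"
  have cle: "\<forall>j\<le>n. cmod (c j) \<le> n" and c1: "1 / n \<le> cmod (c 1)" and cn: "1 / n \<le> cmod (c n)"
    using c by (auto simp: tame_coeffs_def)
  have "0 < 1 / real n" using n by simp
  then have cn0: "c n \<noteq> 0" using cn by auto
  have n1: "n \<ge> 1" using n by simp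
  note f = degree_pderiv_su2_poly[of n c, OF n1 cn0]
  have bd: "cmod (poly ?f z) \<le> (real n + 1) * (real n * (real n * 2 ^ n))" if "cmod z = 1" for z
    using cmod_pderiv_su2_poly_unit_circle_le[OF cle that] .
  \<comment> \<open>\<open>su2_weight n 1\<close> is sqrt n, hence at least 1, and the lower bound
    on \<open>c 1\<close> passes to the value at 0.\<close>
  have "1 / n * 1 \<le> cmod (c 1) * su2_weight n 1"
    using c1 n by (intro mult_mono) auto
  also have "\<dots> = cmod (poly ?f 0)" using poly_pderiv_su2_poly_0[OF n1, of c] by (simp add: norm_mult)
  also have "\<dots> \<le> (real n + 1) * (real n * (real n * 2 ^ n)) * \<delta> ^ card {z. poly ?f z = 0 \<and> cmod z < \<delta>}"
    by (rule card_roots_near_0[OF f(3) d bd])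
  finally show ?near0 unfolding mult_1_right by (rule card_mult_ln_le[OF n1 d(1)])
  have "1 / n * 1 \<le> cmod (c n) * n"
    using cn n by (intro mult_mono) auto
  also have "\<dots> = cmod (lead_coeff ?f)" using f(2) by (simp add: norm_mult)
  also have "\<dots> \<le> (real n + 1) * (real n * (real n * 2 ^ n)) * \<delta> ^ card {z. poly ?f z = 0 \<and> cmod z > 1 / \<delta>}"
    by (rule card_roots_near_infinity[OF f(3) d bd])
  finally show ?near_inf unfolding mult_1_right by (rule card_mult_ln_le[OF n1 d(1)])
qed

text \<open>A shift of size O(1/n) changes 1 + |z|^2 by a factor 1 + O(1/n), whose n-th power stays
  bounded: (1 + 6 \<eta>)^n \<le> e^6, and the square root gives e^3. The distance is
  \<open>2 * \<eta>\<close> because both points will lie within \<eta> of a critical point.\<close>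

lemma fs_weight_le:
  assumes "cmod (w - z) \<le> 2 * \<eta>" "\<eta> * n \<le> 1" "n \<ge> 1" "\<eta> \<ge> 0"
  shows "fs_weight n w \<le> exp 3 * fs_weight n z"
proof -
  have \<eta>1: "\<eta> \<le> 1" using assms mult_left_mono[of 1 "real n" \<eta>] by simp
  have "cmod w \<le> cmod z + 2 * \<eta>" using norm_triangle_ineq[of "w - z" z] assms by simp
  then have "(cmod w)\<^sup>2 \<le> (cmod z + 2 * \<eta>)\<^sup>2" by (intro power_mono) auto
  also have "\<dots> = (cmod z)\<^sup>2 + 2 * \<eta> * (2 * cmod z) + 4 * \<eta>\<^sup>2" by (simp add: power2_eq_square algebra_simps)
  also have "\<dots> \<le> (cmod z)\<^sup>2 + 2 * \<eta> * (1 + (cmod z)\<^sup>2) + 4 * (\<eta> * 1)"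
    unfolding power2_eq_square[of \<eta>] using assms \<eta>1 sum_squares_bound[of 1 "cmod z"]
    by (intro add_mono mult_left_mono) auto
  also have "\<dots> \<le> (cmod z)\<^sup>2 + 6 * \<eta> * (1 + (cmod z)\<^sup>2)"
    using assms by (simp add: algebra_simps)
  finally have "1 + (cmod w)\<^sup>2 \<le> (1 + 6 * \<eta>) * (1 + (cmod z)\<^sup>2)" by (simp add: algebra_simps)
  also have "\<dots> \<le> exp (6 * \<eta>) * (1 + (cmod z)\<^sup>2)"
    using exp_ge_add_one_self[of "6 * \<eta>"] by (intro mult_right_mono) auto
  finally have "(1 + (cmod w)\<^sup>2) ^ n \<le> (exp (6 * \<eta>) * (1 + (cmod z)\<^sup>2)) ^ n" by (intro power_mono) auto
  also have "\<dots> = exp (6 * (\<eta> * n)) * (1 + (cmod z)\<^sup>2) ^ n"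
    by (simp add: power_mult_distrib exp_of_nat_mult[symmetric] mult_ac)
  also have "\<dots> \<le> (exp 3)\<^sup>2 * (1 + (cmod z)\<^sup>2) ^ n"
    using assms by (intro mult_right_mono) (auto simp: power2_eq_square mult_exp_exp)
  finally have "fs_weight n w \<le> sqrt ((exp 3)\<^sup>2 * (1 + (cmod z)\<^sup>2) ^ n)"
    unfolding fs_weight_def by (rule real_sqrt_le_mono)
  then show ?thesis by (simp add: fs_weight_def real_sqrt_mult)
qed

text \<open>Origin of the factors: n + 1 terms, a coefficient of size n, \<open>j * (j - 1)\<close>
  at most n^2, \<open>exp 3\<close> from moving the weight to a nearby point, and
  \<open>1 / \<rho>\<^sup>2\<close> from writing w^(j-2) as w^j / w^2.\<close>

definition hessian_factor :: "nat \<Rightarrow> real \<Rightarrow> real" where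
  "hessian_factor n \<rho> = (real n + 1) * (n ^ 3 * exp 3 / \<rho>\<^sup>2)"

lemma cmod_second_deriv_le:
  assumes c: "\<forall>j\<le>n. cmod (c j) \<le> n" and w: "\<rho> \<le> cmod w" "0 < \<rho>"
    and wz: "cmod (w - z) \<le> 2 * \<eta>" "\<eta> * n \<le> 1" "n \<ge> 1" "\<eta> \<ge> 0"
  shows "cmod (poly (pderiv (pderiv (su2_poly c n))) w) \<le> hessian_factor n \<rho> * fs_weight n z"
proof -
  have "cmod (\<Sum>j\<le>n. c j * (of_nat j * of_nat (j - 1) * su2_weight n j * w ^ (j - 2)))
     \<le> (real n + 1) * (n * (n * n * (exp 3 * fs_weight n z / \<rho>\<^sup>2)))"
  proof (rule cmod_sum_le_card)
    fix j assume j: "j \<le> n"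
    show "cmod (c j * (of_nat j * of_nat (j - 1) * su2_weight n j * w ^ (j - 2)))
        \<le> n * (n * n * (exp 3 * fs_weight n z / \<rho>\<^sup>2))"
    \<comment> \<open>For \<open>j < 2\<close> the factor \<open>j * (j - 1)\<close> kills the term,
      so the truncated exponent \<open>j - 2\<close> does no harm.\<close>
    proof (cases "j \<ge> 2")
      case True
      have "\<rho>\<^sup>2 \<le> (cmod w)\<^sup>2" using w by (intro power_mono) auto
      moreover have "cmod w \<noteq> 0" "w \<noteq> 0" using w by auto
      moreover have "cmod w ^ j = cmod w ^ (j - 2) * (cmod w)\<^sup>2"
        using True by (metis le_add_diff_inverse2 power_add)
      ultimately have "su2_weight n j * cmod w ^ (j - 2) = su2_weight n j * cmod w ^ j / (cmod w)\<^sup>2"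
        by simp
      also have "\<dots> \<le> exp 3 * fs_weight n z / \<rho>\<^sup>2"
        using su2_weight_mult_power_le[of n j w] fs_weight_le[OF wz] w \<open>\<rho>\<^sup>2 \<le> (cmod w)\<^sup>2\<close>
        by (intro frac_le) (auto intro: order_trans)
      finally have "su2_weight n j * cmod w ^ (j - 2) \<le> exp 3 * fs_weight n z / \<rho>\<^sup>2" .
      moreover have "real (j * (j - 1)) \<le> real (n * n)"
        using j by (intro of_nat_mono mult_le_mono) auto
      ultimately have "cmod (c j) * (real j * real (j - 1) * (su2_weight n j * cmod w ^ (j - 2)))
         \<le> n * (n * n * (exp 3 * fs_weight n z / \<rho>\<^sup>2))"
        using c j True by (intro mult_mono) auto
      then show ?thesis by (simp add: norm_mult norm_power mult_ac del: of_nat_diff)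
    next
      case False
      then have "j = 0 \<or> j = 1" by linarith
      then show ?thesis by auto
    qed
  qed
  then show ?thesis
    unfolding hessian_factor_def poly_pderiv_pderiv_su2_poly
    by (simp add: power3_eq_cube mult_ac)
qed

text \<open>Taylor estimate: the first derivative vanishes at \<open>z0\<close>, so the bound on the
  second derivative, integrated once and twice, gives the orders \<eta> and \<eta>^2. The weight is
  taken at \<open>z\<close> and not at \<open>z0\<close>, because probabilities are estimated at a
  fixed \<open>z\<close>. The margin \<open>2 * \<rho>\<close> keeps the disc at distance at least
  \<rho> from 0.\<close>

lemma small_near_critical_point:
  assumes c: "\<forall>j\<le>n. cmod (c j) \<le> n" and z0: "2 * \<rho> \<le> cmod z0" "0 < \<rho>"
    and \<eta>: "\<eta> \<le> \<rho>" "\<eta> * n \<le> 1" "n \<ge> 1" "\<eta> \<ge> 0"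
    and crit: "poly (pderiv (su2_poly c n)) z0 = 0" "cmod (poly (su2_poly c n) z0) \<le> T"
    and z: "cmod (z - z0) \<le> \<eta>"
  defines "S \<equiv> hessian_factor n \<rho> * fs_weight n z"
  shows "cmod (poly (pderiv (su2_poly c n)) z) \<le> \<eta> * S"
    and "cmod (poly (su2_poly c n) z) \<le> T + \<eta>\<^sup>2 * S"
proof -
  let ?p = "su2_poly c n"
  have S0: "S \<ge> 0" unfolding S_def hessian_factor_def
    by (intro mult_nonneg_nonneg) (auto intro: less_imp_le)
  have "z0 \<in> cball z0 \<eta>" using \<eta> by simp
  have d2: "cmod (poly (pderiv (pderiv ?p)) w) \<le> S" if "w \<in> cball z0 \<eta>" for w
    unfolding S_def
  proof (rule cmod_second_deriv_le[OF c _ _ _ \<eta>(2-4)])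
    show "\<rho> \<le> cmod w" using that norm_triangle_ineq2[of z0 w] z0 \<eta> by (simp add: dist_norm)
    show "cmod (w - z) \<le> 2 * \<eta>"
      using that z norm_triangle_ineq4[of "w - z0" "z - z0"] by (simp add: dist_norm norm_minus_commute)
  qed fact
  have d1: "cmod (poly (pderiv ?p) w) \<le> \<eta> * S" if w: "w \<in> cball z0 \<eta>" for w
  proof -
    have "cmod (poly (pderiv ?p) w - poly (pderiv ?p) z0) \<le> S * cmod (w - z0)"
      using w \<open>z0 \<in> cball z0 \<eta>\<close>
      by (intro field_differentiable_bound[of "cball z0 \<eta>" _ "poly (pderiv (pderiv ?p))"] d2)
         (auto intro!: poly_DERIV has_field_derivative_at_within)
    also have "\<dots> \<le> S * \<eta>" using w S0 by (intro mult_left_mono) (auto simp: dist_norm norm_minus_commute)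
    finally show ?thesis by (simp add: crit mult_ac)
  qed
  have zin: "z \<in> cball z0 \<eta>" using z by (simp add: dist_norm norm_minus_commute)
  show "cmod (poly (pderiv ?p) z) \<le> \<eta> * S" by (rule d1[OF zin])
  have "cmod (poly ?p z - poly ?p z0) \<le> \<eta> * S * cmod (z - z0)"
    using zin \<open>z0 \<in> cball z0 \<eta>\<close>
    by (intro field_differentiable_bound[of "cball z0 \<eta>" _ "poly (pderiv ?p)"] d1)
       (auto intro!: poly_DERIV has_field_derivative_at_within)
  also have "\<dots> \<le> \<eta> * S * \<eta>" using z S0 \<eta> by (intro mult_left_mono) auto
  finally show "cmod (poly ?p z) \<le> T + \<eta>\<^sup>2 * S"
    using crit(2) norm_triangle_ineq[of "poly ?p z - poly ?p z0" "poly ?p z0"]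
    by (simp add: power2_eq_square mult_ac)
qed

text \<open>Meant for s = |z|^2, where the terms are the variances of the summands of p_n(z). The
  largest term is at least the average, and the ratio s (n - j) / (j + 1) of consecutive terms is at
  least \<kappa> / n.\<close>

lemma adjacent_large_binomial_terms:
  fixes s \<kappa> :: real
  assumes n: "n \<ge> 1" and s: "\<kappa> \<le> s" "s \<le> 1 / \<kappa>" "0 < \<kappa>"
  obtains m where "m < n"
    "\<And>j. j \<in> {m, Suc m} \<Longrightarrow> \<kappa> / (real n * (real n + 1)) * (1 + s) ^ n \<le> real (n choose j) * s ^ j"
proof -
  let ?t = "\<lambda>j. real (n choose j) * s ^ j"
  have s0: "0 < s" and k1: "\<kappa> \<le> 1"
  proof -
    show "0 < s" using s by simp
    have "\<kappa> \<le> 1 / \<kappa>" using s by linarith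
    then have "\<kappa> * \<kappa> \<le> 1 * 1" using s by (simp add: field_simps)
    then show "\<kappa> \<le> 1" using s(3) by (metis mult_strict_mono not_le less_eq_real_def zero_less_one)
  qed
  have step: "?t (Suc j) * real (Suc j) = ?t j * (s * (real n - real j))" if "j < n" for j
  proof -
    have "real (Suc j * (n choose Suc j)) = real ((n - j) * (n choose j))"
      using binomial_absorption[of j n] binomial_absorb_comp[of n j] by presburger
    then have "real (Suc j) * real (n choose Suc j) = (real n - real j) * real (n choose j)"
      using that by (simp only: of_nat_mult of_nat_diff less_imp_le)
    then have "s * s ^ j * (real (Suc j) * real (n choose Suc j)) = s * s ^ j * ((real n - real j) * real (n choose j))"
      by (rule arg_cong)
    then show ?thesis by (simp only: mult_ac power_Suc)
  qed
  obtain m where m: "m \<le> n" and max: "\<And>j. j \<le> n \<Longrightarrow> ?t j \<le> ?t m"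
  proof -
    have "Max (?t ` {..n}) \<in> ?t ` {..n}" by (rule Max_in) auto
    then obtain m where m: "m \<le> n" "Max (?t ` {..n}) = ?t m" by (auto simp only: image_iff atMost_iff)
    have "?t j \<le> ?t m" if "j \<le> n" for j
      unfolding m(2)[symmetric] using that by (intro Max_ge) auto
    with m that show ?thesis by blast
  qed
  have big: "(1 + s) ^ n \<le> (real n + 1) * ?t m"
  proof -
    have "(1 + s) ^ n = (\<Sum>j\<le>n. ?t j)"
      using binomial_ring[of s "1::real" n] by (simp add: add.commute)
    also have "\<dots> \<le> (\<Sum>j\<le>n. ?t m)" by (intro sum_mono max) auto
    finally show ?thesis by (simp add: add.commute)
  qed
  have large: "\<kappa> / (real n * (real n + 1)) * (1 + s) ^ n \<le> x" if "?t m * (\<kappa> / n) \<le> x" for x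
  proof -
    have "\<kappa> / (real n * (real n + 1)) * (1 + s) ^ n \<le> \<kappa> / (real n * (real n + 1)) * ((real n + 1) * ?t m)"
      using s by (intro mult_left_mono big) auto
    also have "\<dots> = ?t m * (\<kappa> / n)" using n by (simp add: divide_simps)
    finally show ?thesis using that by linarith
  qed
  have "\<kappa> / n \<le> 1" using k1 n by (simp add: field_simps)
  then have "?t m * (\<kappa> / n) \<le> ?t m * 1" using s0 by (intro mult_left_mono) auto
  then have tm: "?t m * (\<kappa> / n) \<le> ?t m" by simp
  show ?thesis
  proof (cases "m < n")
    case True
    have "?t m * (\<kappa> / n) \<le> ?t m * (s * (real n - real m) / real (Suc m))"
    proof (intro mult_left_mono)
      have "\<kappa> * 1 / n \<le> s * (real n - real m) / real (Suc m)"
        using s True by (intro frac_le mult_mono) auto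
      then show "\<kappa> / n \<le> s * (real n - real m) / real (Suc m)" by simp
    qed (use s0 in auto)
    also have "\<dots> = ?t (Suc m)" using step[OF True] by (simp add: field_simps)
    finally have "?t m * (\<kappa> / n) \<le> ?t (Suc m)" .
    then show ?thesis using that[of m] True tm large by blast
  next
    case False
    then have mn: "m = n" using m by simp
    \<comment> \<open>When the last term is the largest, the neighbour is taken on the left; the
      ratio is now n / s, and s \<le> 1 / \<kappa> keeps it above \<kappa> / n.\<close>
    define l where "l = n - 1"
    have l: "l < n" "Suc l = n" using n by (auto simp: l_def)
    have "real n - real l = 1" using l by linarith
    then have "?t n * real n = ?t l * s" using step[OF l(1)] unfolding l(2) by simp
    then have "?t l = ?t n * (real n / s)" using s0 by (simp add: field_simps)
    moreover have "\<kappa> / n \<le> real n / s"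
    proof -
      have "\<kappa> * s \<le> 1" using s by (simp add: field_simps)
      also have "1 \<le> real n * real n" using n by (metis mult_mono' mult_1 of_nat_1 of_nat_le_iff zero_le_one)
      finally show ?thesis using s0 n by (simp add: field_simps)
    qed
    ultimately have "?t m * (\<kappa> / n) \<le> ?t l"
      using s0 mn mult_left_mono[of "\<kappa> / n" "real n / s" "?t m"] by auto
    then show ?thesis using that[of l] l mn tm large by blast
  qed
qed

subsection \<open>Small ball estimates\<close>

lemma emeasure_lborel_cball_complex:
  assumes "r \<ge> 0"
  shows "emeasure lborel (cball (x :: complex) r) = ennreal (pi * r\<^sup>2)"
  using assms by (simp add: emeasure_cball unit_ball_vol_2 mult_ac)

context prob_space
begin

text \<open>Conditioning on \<open>Y\<close>: by independence the law of the pair is the product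
  law, so a bound on every fibre over \<open>y\<close> may be integrated.\<close>

lemma emeasure_indep_pair_le:
  assumes ind: "indep_var S X N Y" and E: "E \<in> sets (S \<Otimes>\<^sub>M N)" and B: "B \<in> sets N"
    and le: "\<And>y. y \<in> space N \<Longrightarrow>
      emeasure (distr M S X) {x \<in> space S. (x, y) \<in> E} \<le> C * indicator B y"
  shows "emeasure M {\<omega> \<in> space M. (X \<omega>, Y \<omega>) \<in> E} \<le> C * emeasure M {\<omega> \<in> space M. Y \<omega> \<in> B}"
proof -
  have rv [measurable]: "random_variable S X" "random_variable N Y"
    and eq: "distr M S X \<Otimes>\<^sub>M distr M N Y = distr M (S \<Otimes>\<^sub>M N) (\<lambda>\<omega>. (X \<omega>, Y \<omega>))"
    using ind by (simp_all add: indep_var_distribution_eq)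
  interpret X: prob_space "distr M S X" by (rule prob_space_distr) fact
  interpret Y: prob_space "distr M N Y" by (rule prob_space_distr) fact
  interpret XY: pair_sigma_finite "distr M S X" "distr M N Y" ..
  have "emeasure M {\<omega> \<in> space M. (X \<omega>, Y \<omega>) \<in> E} = emeasure (distr M S X \<Otimes>\<^sub>M distr M N Y) E"
    unfolding eq using E by (subst emeasure_distr) (auto simp: vimage_def Int_def conj_commute)
  also have "\<dots> = (\<integral>\<^sup>+y. emeasure (distr M S X) ((\<lambda>x. (x, y)) -` E) \<partial>distr M N Y)"
    by (rule XY.emeasure_pair_measure_alt2)
       (use E in \<open>simp cong: sets_pair_measure_cong\<close>)
  also have "\<dots> \<le> (\<integral>\<^sup>+y. C * indicator B y \<partial>distr M N Y)"
  proof (rule nn_integral_mono)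
    fix y assume y: "y \<in> space (distr M N Y)"
    have "(\<lambda>x. (x, y)) -` E = {x \<in> space S. (x, y) \<in> E}"
      using sets.sets_into_space[OF E] by (auto simp: space_pair_measure)
    then show "emeasure (distr M S X) ((\<lambda>x. (x, y)) -` E) \<le> C * indicator B y"
      using le[of y] y by simp
  qed
  also have "\<dots> = C * emeasure (distr M N Y) B"
    using B by (subst nn_integral_cmult_indicator) auto
  also have "emeasure (distr M N Y) B = emeasure M {\<omega> \<in> space M. Y \<omega> \<in> B}"
    using B by (subst emeasure_distr) (auto simp: vimage_def Int_def conj_commute)
  finally show ?thesis .
qed

end

section \<open>The law of a single Gaussian coefficient, and linear forms in the
  coefficients\<close>

locale gaussian_coeffs = prob_space +
  fixes a :: "nat \<Rightarrow> 'a \<Rightarrow> complex"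
  assumes indep: "indep_vars (\<lambda>_. borel) a UNIV"
    and distributed_a: "\<And>j. distributed M lborel (a j) (\<lambda>z. ennreal (1 / pi * exp (- (cmod z)\<^sup>2)))"
begin

lemma measurable_a [measurable]: "a j \<in> borel_measurable M"
  using distributed_measurable[OF distributed_a[of j]] by simp

lemma distr_a: "distr M borel (a j) = density lborel (\<lambda>z. ennreal (1 / pi * exp (- (cmod z)\<^sup>2)))"
proof -
  have "distr M borel (a j) = distr M lborel (a j)" by (rule distr_cong) auto
  then show ?thesis using distributed_distr_eq_density[OF distributed_a[of j]] by simp
qed

text \<open>The density never exceeds 1/pi, which cancels the pi of the area.\<close>

lemma emeasure_distr_a_cball:
  assumes "r \<ge> 0"
  shows "emeasure (distr M borel (a j)) (cball c r) \<le> ennreal (r\<^sup>2)"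
proof -
  have "emeasure (distr M borel (a j)) (cball c r)
      = (\<integral>\<^sup>+z. ennreal (1 / pi * exp (- (cmod z)\<^sup>2)) * indicator (cball c r) z \<partial>lborel)"
    unfolding distr_a by (subst emeasure_density) auto
  also have "\<dots> \<le> (\<integral>\<^sup>+z. ennreal (1 / pi) * indicator (cball c r) z \<partial>lborel)"
    by (intro nn_integral_mono mult_right_mono ennreal_leI) (auto simp: field_simps)
  also have "\<dots> = ennreal (1 / pi) * ennreal (pi * r\<^sup>2)"
    using emeasure_lborel_cball_complex[OF assms, of c]
    by (subst nn_integral_cmult_indicator) auto
  also have "\<dots> = ennreal (r\<^sup>2)" by (simp flip: ennreal_mult')
  finally show ?thesis .
qed

lemma emeasure_distr_a_countable:
  assumes "countable A"
  shows "emeasure (distr M borel (a j)) A = 0"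
proof -
  have "A \<in> null_sets lborel" using assms by (rule countable_imp_null_set_lborel)
  then have "A \<in> null_sets (density lborel (\<lambda>z. ennreal (1 / pi * exp (- (cmod z)\<^sup>2))))"
    by (subst null_sets_density_iff) (auto dest: AE_not_in)
  then show ?thesis by (simp add: distr_a null_sets_def)
qed

text \<open>The Gaussian density is not integrated here: substituting $z \mapsto \sqrt 2 z$ in the total
  mass of \<^term>\<open>exp (- (cmod z)\<^sup>2)\<close> gives the factor 2.\<close>

lemma nn_integral_exp_half:
  "(\<integral>\<^sup>+z. ennreal (1 / pi * exp (- (cmod z)\<^sup>2 / 2)) \<partial>lborel) = 2"
proof -
  have "prob_space (distr M borel (a 0))" by (rule prob_space_distr) auto
  then have one: "(\<integral>\<^sup>+z. ennreal (1 / pi * exp (- (cmod z)\<^sup>2)) \<partial>lborel) = 1"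
    using prob_space.emeasure_space_1 by (fastforce simp: distr_a emeasure_density)
  have "(\<integral>\<^sup>+z. ennreal (1 / pi * exp (- (cmod z)\<^sup>2 / 2)) \<partial>lborel)
      = (\<integral>\<^sup>+z. ennreal (1 / pi * exp (- (cmod z)\<^sup>2 / 2)) \<partial>density (distr lborel borel (\<lambda>x :: complex. 0 + sqrt 2 *\<^sub>R x)) (\<lambda>_. ennreal (\<bar>sqrt 2\<bar> ^ DIM(complex))))"
    using lborel_affine[of "sqrt 2" "0 :: complex"] by simp
  also have "\<dots> = (\<integral>\<^sup>+z. 2 * ennreal (1 / pi * exp (- (cmod z)\<^sup>2)) \<partial>lborel)"
    by (subst nn_integral_density, simp, simp, subst nn_integral_distr)
       (auto simp: power_mult_distrib)
  also have "\<dots> = 2" by (subst nn_integral_cmult) (measurable, simp only: one mult_1_right)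
  finally show ?thesis .
qed

text \<open>Half of the exponent is bounded by its value at \<open>r\<close>; the other half
  integrates to 2.\<close>

lemma prob_a_gt:
  assumes "r \<ge> 0"
  shows "prob {\<omega> \<in> space M. cmod (a j \<omega>) > r} \<le> 2 * exp (- r\<^sup>2 / 2)"
proof -
  have "emeasure M {\<omega> \<in> space M. cmod (a j \<omega>) > r} = emeasure (distr M borel (a j)) {z. cmod z > r}"
    by (subst emeasure_distr) (auto simp: vimage_def Int_def conj_commute)
  also have "\<dots> = (\<integral>\<^sup>+z. ennreal (1 / pi * exp (- (cmod z)\<^sup>2)) * indicator {z. cmod z > r} z \<partial>lborel)"
    unfolding distr_a by (subst emeasure_density) auto
  also have "\<dots> \<le> (\<integral>\<^sup>+z. ennreal (exp (- r\<^sup>2 / 2)) * ennreal (1 / pi * exp (- (cmod z)\<^sup>2 / 2)) \<partial>lborel)"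
  proof (rule nn_integral_mono)
    fix z :: complex
    show "ennreal (1 / pi * exp (- (cmod z)\<^sup>2)) * indicator {z. cmod z > r} z
       \<le> ennreal (exp (- r\<^sup>2 / 2)) * ennreal (1 / pi * exp (- (cmod z)\<^sup>2 / 2))"
    proof (cases "cmod z > r")
      case True
      then have "r\<^sup>2 \<le> (cmod z)\<^sup>2" using assms by (intro power_mono) auto
      then have "exp (- (cmod z)\<^sup>2) \<le> exp (- r\<^sup>2 / 2) * exp (- (cmod z)\<^sup>2 / 2)"
        by (simp add: mult_exp_exp)
      then show ?thesis using True by (simp flip: ennreal_mult'') (simp add: field_simps ennreal_leI)
    qed simp
  qed
  also have "\<dots> = ennreal (exp (- r\<^sup>2 / 2)) * 2"
    by (subst nn_integral_cmult) (measurable, simp only: nn_integral_exp_half)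
  also have "\<dots> = ennreal (2 * exp (- r\<^sup>2 / 2))"
    by (simp add: ennreal_mult'' mult.commute)
  finally show ?thesis by (simp add: emeasure_eq_measure)
qed

lemma prob_a_le:
  assumes "r \<ge> 0"
  shows "prob {\<omega> \<in> space M. cmod (a j \<omega>) \<le> r} \<le> r\<^sup>2"
proof -
  have "emeasure M {\<omega> \<in> space M. cmod (a j \<omega>) \<le> r} = emeasure (distr M borel (a j)) (cball 0 r)"
    by (subst emeasure_distr) (auto simp: vimage_def Int_def conj_commute)
  also note emeasure_distr_a_cball[OF assms]
  finally show ?thesis by (simp add: emeasure_eq_measure)
qed

text \<open>The predicate \<open>indep_var\<close> requires both variables to have the same range type, whence the detour
  through the product over the singleton \<open>{i}\<close>.\<close>

lemma emeasure_coeff_rest_le: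
  assumes iJ: "i \<notin> J" and E [measurable]: "E \<in> sets (borel \<Otimes>\<^sub>M PiM J (\<lambda>_. borel))"
    and B: "B \<in> sets (PiM J (\<lambda>_. borel))"
    and le: "\<And>y. y \<in> space (PiM J (\<lambda>_. borel)) \<Longrightarrow>
      emeasure (distr M borel (a i)) {x. (x, y) \<in> E} \<le> C * indicator B y"
  shows "emeasure M {\<omega> \<in> space M. (a i \<omega>, \<lambda>j\<in>J. a j \<omega>) \<in> E}
    \<le> C * emeasure M {\<omega> \<in> space M. (\<lambda>j\<in>J. a j \<omega>) \<in> B}"
proof -
  let ?S = "PiM {i} (\<lambda>_. borel :: complex measure)" and ?N = "PiM J (\<lambda>_. borel :: complex measure)"
  let ?X = "\<lambda>\<omega>. \<lambda>j\<in>{i}. a j \<omega>"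
  have ind: "indep_var ?S ?X ?N (\<lambda>\<omega>. \<lambda>j\<in>J. a j \<omega>)"
    using iJ by (intro indep_var_restrict[OF indep]) auto
  define E' where "E' = {xy \<in> space (?S \<Otimes>\<^sub>M ?N). (fst xy i, snd xy) \<in> E}"
  have E': "E' \<in> sets (?S \<Otimes>\<^sub>M ?N)" unfolding E'_def by measurable
  have "emeasure M {\<omega> \<in> space M. (?X \<omega>, \<lambda>j\<in>J. a j \<omega>) \<in> E'}
      \<le> C * emeasure M {\<omega> \<in> space M. (\<lambda>j\<in>J. a j \<omega>) \<in> B}"
  proof (rule emeasure_indep_pair_le[OF ind E' B])
    fix y assume y [measurable]: "y \<in> space ?N"
    have X [measurable]: "?X \<in> measurable M ?S" by measurable
    have "emeasure (distr M ?S ?X) {x \<in> space ?S. (x, y) \<in> E'}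
        = emeasure M {\<omega> \<in> space M. (a i \<omega>, y) \<in> E}"
    proof (subst emeasure_distr[OF X])
      have "{x \<in> space ?S. (x i, y) \<in> E} \<in> sets ?S" by measurable
      then show "{x \<in> space ?S. (x, y) \<in> E'} \<in> sets ?S"
        using y by (simp add: E'_def space_pair_measure conj_commute cong: conj_cong)
      show "emeasure M (?X -` {x \<in> space ?S. (x, y) \<in> E'} \<inter> space M) = emeasure M {\<omega> \<in> space M. (a i \<omega>, y) \<in> E}"
        using y measurable_space[OF X]
        by (intro arg_cong[where f = "emeasure M"]) (auto simp: E'_def space_pair_measure)
    qed
    also have "\<dots> = emeasure (distr M borel (a i)) {x. (x, y) \<in> E}"
    proof (subst emeasure_distr)
      have "{x \<in> space borel. (x, y) \<in> E} \<in> sets borel" by measurable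
      then show "{x. (x, y) \<in> E} \<in> sets borel" by simp
    qed (auto simp: vimage_def Int_def conj_commute)
    finally show "emeasure (distr M ?S ?X) {x \<in> space ?S. (x, y) \<in> E'} \<le> C * indicator B y"
      using le[OF y] by simp
  qed
  also have "{\<omega> \<in> space M. (?X \<omega>, \<lambda>j\<in>J. a j \<omega>) \<in> E'} = {\<omega> \<in> space M. (a i \<omega>, \<lambda>j\<in>J. a j \<omega>) \<in> E}"
    by (auto simp: E'_def space_pair_measure space_PiM)
  finally show ?thesis .
qed

text \<open>Pivot argument: once the other coefficients are fixed, the first condition confines
  \<open>a i\<close> to a disc of radius \<open>r / cmod (w i)\<close>. The event \<open>B\<close>
  on the other coefficients is carried along so that its probability can be estimated in a further
  round.\<close>

lemma small_ball_linear_form: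
  assumes I: "finite I" "i \<in> I" and w: "w i \<noteq> 0" and r: "r \<ge> 0"
    and B [measurable]: "B \<in> sets (PiM (I - {i}) (\<lambda>_. borel))"
  shows "emeasure M {\<omega> \<in> space M. cmod (\<Sum>j\<in>I. a j \<omega> * w j) \<le> r \<and> (\<lambda>j\<in>I - {i}. a j \<omega>) \<in> B}
    \<le> ennreal ((r / cmod (w i))\<^sup>2) * emeasure M {\<omega> \<in> space M. (\<lambda>j\<in>I - {i}. a j \<omega>) \<in> B}"
proof -
  let ?N = "PiM (I - {i}) (\<lambda>_. borel :: complex measure)"
  define E where "E = {(x, y). (x, y) \<in> space (borel \<Otimes>\<^sub>M ?N) \<and>
    cmod (x * w i + (\<Sum>j\<in>I - {i}. y j * w j)) \<le> r \<and> y \<in> B}"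
  have E: "E \<in> sets (borel \<Otimes>\<^sub>M ?N)"
    unfolding E_def case_prod_beta' prod.collapse by measurable
  have "emeasure M {\<omega> \<in> space M. (a i \<omega>, \<lambda>j\<in>I - {i}. a j \<omega>) \<in> E}
      \<le> ennreal ((r / cmod (w i))\<^sup>2) * emeasure M {\<omega> \<in> space M. (\<lambda>j\<in>I - {i}. a j \<omega>) \<in> B}"
  proof (rule emeasure_coeff_rest_le[OF _ E B])
    fix y assume "y \<in> space ?N"
    show "emeasure (distr M borel (a i)) {x. (x, y) \<in> E}
        \<le> ennreal ((r / cmod (w i))\<^sup>2) * indicator B y"
    proof (cases "y \<in> B")
      case True
      define c where "c = - (\<Sum>j\<in>I - {i}. y j * w j) / w i"
      have "{x. (x, y) \<in> E} \<subseteq> cball c (r / cmod (w i))"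
      proof
        fix x assume "x \<in> {x. (x, y) \<in> E}"
        then have "cmod (x * w i + (\<Sum>j\<in>I - {i}. y j * w j)) \<le> r" by (simp add: E_def)
        also have "x * w i + (\<Sum>j\<in>I - {i}. y j * w j) = (x - c) * w i"
          using w by (simp add: c_def field_simps)
        finally have "cmod (x - c) \<le> r / cmod (w i)"
          using w by (simp add: norm_mult pos_le_divide_eq)
        then show "x \<in> cball c (r / cmod (w i))"
          by (simp add: dist_norm norm_minus_commute)
      qed
      then have "emeasure (distr M borel (a i)) {x. (x, y) \<in> E}
          \<le> emeasure (distr M borel (a i)) (cball c (r / cmod (w i)))"
        by (intro emeasure_mono) auto
      also have "\<dots> \<le> ennreal ((r / cmod (w i))\<^sup>2)"
        using r by (intro emeasure_distr_a_cball) auto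
      finally show ?thesis using True by simp
    qed (simp add: E_def)
  qed simp
  also have "{\<omega> \<in> space M. (a i \<omega>, \<lambda>j\<in>I - {i}. a j \<omega>) \<in> E} =
     {\<omega> \<in> space M. cmod (\<Sum>j\<in>I. a j \<omega> * w j) \<le> r \<and> (\<lambda>j\<in>I - {i}. a j \<omega>) \<in> B}"
    using sum.remove[OF I, of "\<lambda>j. a j _ * w j"]
    by (auto simp: E_def space_pair_measure space_PiM)
  finally show ?thesis .
qed

text \<open>As the second form does not involve \<open>a i\<close>, the estimate follows by conditioning first on all
  coefficients except \<open>a i\<close> and then on all coefficients except \<open>a i\<close> and \<open>a k\<close>.\<close>

lemma small_ball_two_linear_forms:
  assumes I: "finite I" "i \<in> I" "k \<in> I" "i \<noteq> k"
    and w: "w i \<noteq> 0" and v: "v i = 0" "v k \<noteq> 0" and r: "r \<ge> 0" "s \<ge> 0"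
  shows "emeasure M {\<omega> \<in> space M. cmod (\<Sum>j\<in>I. a j \<omega> * w j) \<le> r \<and> cmod (\<Sum>j\<in>I. a j \<omega> * v j) \<le> s}
    \<le> ennreal ((r / cmod (w i))\<^sup>2 * (s / cmod (v k))\<^sup>2)"
proof -
  let ?N = "PiM (I - {i}) (\<lambda>_. borel :: complex measure)"
  define B where "B = {y \<in> space ?N. cmod (\<Sum>j\<in>I - {i}. y j * v j) \<le> s}"
  have B: "B \<in> sets ?N" unfolding B_def by measurable
  have inB: "(\<lambda>j\<in>I - {i}. a j \<omega>) \<in> B \<longleftrightarrow> cmod (\<Sum>j\<in>I - {i}. a j \<omega> * v j) \<le> s" for \<omega>
    by (simp add: B_def space_PiM)
  have sum: "(\<Sum>j\<in>I. a j \<omega> * v j) = (\<Sum>j\<in>I - {i}. a j \<omega> * v j)" for \<omega>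
    using sum.remove[OF I(1,2), of "\<lambda>j. a j \<omega> * v j"] v by simp
  \<comment> \<open>The second round: pivot \<open>k\<close> on the index set
    \<open>I - {i}\<close>, with the whole space as the remaining condition.\<close>
  have "emeasure M {\<omega> \<in> space M. (\<lambda>j\<in>I - {i}. a j \<omega>) \<in> B} \<le> ennreal ((s / cmod (v k))\<^sup>2)"
    using small_ball_linear_form[of "I - {i}" k v s "space (PiM (I - {i} - {k}) (\<lambda>_. borel))"] I v r
    unfolding inB by (simp add: space_PiM emeasure_space_1)
  then have le: "ennreal ((r / cmod (w i))\<^sup>2) * emeasure M {\<omega> \<in> space M. (\<lambda>j\<in>I - {i}. a j \<omega>) \<in> B}
      \<le> ennreal ((r / cmod (w i))\<^sup>2) * ennreal ((s / cmod (v k))\<^sup>2)"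
    by (rule mult_left_mono) simp
  have "emeasure M {\<omega> \<in> space M. cmod (\<Sum>j\<in>I. a j \<omega> * w j) \<le> r \<and> cmod (\<Sum>j\<in>I. a j \<omega> * v j) \<le> s}
     = emeasure M {\<omega> \<in> space M. cmod (\<Sum>j\<in>I. a j \<omega> * w j) \<le> r \<and> (\<lambda>j\<in>I - {i}. a j \<omega>) \<in> B}"
    unfolding inB sum ..
  also have "\<dots> \<le> ennreal ((r / cmod (w i))\<^sup>2) * emeasure M {\<omega> \<in> space M. (\<lambda>j\<in>I - {i}. a j \<omega>) \<in> B}"
    by (rule small_ball_linear_form[where I = I and i = i and w = w and B = B, OF I(1,2) w r(1) B])
  also note le
  finally show ?thesis by (subst ennreal_mult) simp_all
qed

end

subsection \<open>Small critical values and double critical points\<close>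

lemma card_roots_rsquarefree:
  fixes p :: "complex poly"
  assumes "rsquarefree p"
  shows "card {z. poly p z = 0} = degree p"
proof -
  have p0: "p \<noteq> 0" using assms by (simp add: rsquarefree_def)
  have "degree p = degree (smult (lead_coeff p) (\<Prod>z|poly p z = 0. [:-z, 1:]))"
    by (simp only: complex_poly_decompose_rsquarefree[OF assms])
  also have "\<dots> = (\<Sum>z|poly p z = 0. degree [:-z, 1:])"
    using p0 by (simp add: degree_prod_eq_sum_degree)
  finally show ?thesis by simp
qed

text \<open>The share of the variance (1 + |z|^2)^n that each of two adjacent terms is guaranteed to
  carry on the annulus \<rho> \<le> |z| \<le> 1/\<rho>: the constant of
  \<open>adjacent_large_binomial_terms\<close> for \<kappa> = \<rho>^2.\<close>

definition nondegeneracy :: "nat \<Rightarrow> real \<Rightarrow> real" where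
  "nondegeneracy n \<rho> = \<rho>\<^sup>2 / (real n * (real n + 1))"

context gaussian_coeffs
begin

abbreviation rand_poly :: "nat \<Rightarrow> 'a \<Rightarrow> complex poly" where
  "rand_poly n \<omega> \<equiv> su2_poly (\<lambda>j. a j \<omega>) n"

text \<open>The form $z p'(z) - m p(z)$ does not involve the coefficient of index \<open>m\<close>, which makes the pair
  of forms triangular; \<open>m\<close> is chosen such that the two pivots are nearly as large as possible.\<close>

lemma prob_small_value_and_derivative:
  assumes n: "n \<ge> 1" and \<rho>: "0 < \<rho>" and z: "\<rho> \<le> cmod z" "cmod z \<le> 1 / \<rho>" and \<alpha>: "\<alpha> \<ge> 0" and \<beta>: "\<beta> \<ge> 0"
  shows "emeasure M {\<omega> \<in> space M. cmod (poly (rand_poly n \<omega>) z) \<le> \<alpha> * fs_weight n z \<and>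
      cmod (poly (pderiv (rand_poly n \<omega>)) z) \<le> \<beta> * fs_weight n z}
    \<le> ennreal (\<alpha>\<^sup>2 * (\<beta> / \<rho> + n * \<alpha>)\<^sup>2 / (nondegeneracy n \<rho>)\<^sup>2)"
proof -
  let ?W = "fs_weight n z"
  define \<theta> where "\<theta> = nondegeneracy n \<rho>"
  have \<theta>: "\<theta> > 0" using n \<rho> by (simp add: \<theta>_def nondegeneracy_def)
  define w :: "nat \<Rightarrow> complex" where "w j = su2_weight n j * z ^ j" for j
  have s: "\<rho>\<^sup>2 \<le> (cmod z)\<^sup>2" "(cmod z)\<^sup>2 \<le> 1 / \<rho>\<^sup>2" "0 < \<rho>\<^sup>2"
  proof -
    show "\<rho>\<^sup>2 \<le> (cmod z)\<^sup>2" using z \<rho> by (intro power_mono) auto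
    have "(cmod z)\<^sup>2 \<le> (1 / \<rho>)\<^sup>2" using z \<rho> by (intro power_mono) auto
    then show "(cmod z)\<^sup>2 \<le> 1 / \<rho>\<^sup>2" by (simp add: power_divide)
  qed (use \<rho> in simp)
  obtain m where m: "m < n" and large: "\<And>j. j \<in> {m, Suc m} \<Longrightarrow>
      \<rho>\<^sup>2 / (real n * (real n + 1)) * (1 + (cmod z)\<^sup>2) ^ n \<le> real (n choose j) * ((cmod z)\<^sup>2) ^ j"
    using adjacent_large_binomial_terms[OF n s] by blast
  have wl: "\<theta> * ?W\<^sup>2 \<le> (cmod (w j))\<^sup>2" if "j \<in> {m, Suc m}" for j
  proof -
    have "(cmod (w j))\<^sup>2 = real (n choose j) * ((cmod z)\<^sup>2) ^ j"
      by (simp add: w_def norm_mult norm_power power_mult_distrib flip: power_mult) (simp add: mult.commute)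
    moreover have "?W\<^sup>2 = (1 + (cmod z)\<^sup>2) ^ n" by (simp add: fs_weight_def)
    ultimately show ?thesis using large[OF that] by (simp add: \<theta>_def nondegeneracy_def)
  qed
  have pos: "0 < \<theta> * ?W\<^sup>2" using \<theta> by (intro mult_pos_pos zero_less_power) simp_all
  have w0: "w j \<noteq> 0" if "j \<in> {m, Suc m}" for j
    using wl[OF that] pos by auto
  have ratio: "(x * ?W / cmod (w j))\<^sup>2 \<le> x\<^sup>2 / \<theta>" if "j \<in> {m, Suc m}" for x j
  proof -
    have "(x * ?W / cmod (w j))\<^sup>2 = (x * ?W)\<^sup>2 / (cmod (w j))\<^sup>2" by (simp add: power_divide)
    also have "\<dots> \<le> (x * ?W)\<^sup>2 / (\<theta> * ?W\<^sup>2)"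
      using wl[OF that] pos \<theta> by (intro divide_left_mono mult_pos_pos) (auto simp: w0[OF that])
    also have "\<dots> = x\<^sup>2 / \<theta>"
      using less_imp_neq[OF fs_weight_pos[of n z]] by (simp add: power_mult_distrib)
    finally show ?thesis .
  qed
  \<comment> \<open>The multiplier j - m is 1 at \<open>Suc m\<close>, so
    \<open>v (Suc m) = w (Suc m)\<close>. The pivots are therefore \<open>w m\<close> and
    \<open>w (Suc m)\<close>, which is why the two large terms have to be adjacent.\<close>
  define v :: "nat \<Rightarrow> complex" where "v j = (of_nat j - of_nat m) * w j" for j
  have p: "poly (rand_poly n \<omega>) z = (\<Sum>j\<le>n. a j \<omega> * w j)" for \<omega>
    by (simp add: poly_su2_poly w_def)
  have q: "z * poly (pderiv (rand_poly n \<omega>)) z - of_nat m * poly (rand_poly n \<omega>) z = (\<Sum>j\<le>n. a j \<omega> * v j)" for \<omega>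
  proof -
    have zj: "z * (of_nat j * z ^ (j - 1)) = of_nat j * z ^ j" for j
      by (cases j) auto
    have "z * poly (pderiv (rand_poly n \<omega>)) z = (\<Sum>j\<le>n. a j \<omega> * su2_weight n j * (z * (of_nat j * z ^ (j - 1))))"
      unfolding poly_pderiv_su2_poly sum_distrib_left by (intro sum.cong) (simp_all add: mult_ac)
    also have "\<dots> = (\<Sum>j\<le>n. a j \<omega> * of_nat j * w j)"
      unfolding zj w_def by (intro sum.cong) (simp_all add: mult_ac)
    finally show ?thesis
      unfolding p v_def sum_distrib_left by (simp add: sum_subtractf[symmetric] algebra_simps)
  qed
  define \<gamma> where "\<gamma> = \<beta> / \<rho> + n * \<alpha>"
  have \<gamma>: "\<gamma> \<ge> 0" using \<alpha> \<beta> \<rho> by (simp add: \<gamma>_def)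
  have [measurable]: "(\<lambda>\<omega>. poly (rand_poly n \<omega>) z) \<in> borel_measurable M"
    unfolding poly_su2_poly by measurable
  have "emeasure M {\<omega> \<in> space M. cmod (poly (rand_poly n \<omega>) z) \<le> \<alpha> * ?W \<and>
      cmod (poly (pderiv (rand_poly n \<omega>)) z) \<le> \<beta> * ?W}
    \<le> emeasure M {\<omega> \<in> space M. cmod (\<Sum>j\<le>n. a j \<omega> * w j) \<le> \<alpha> * ?W \<and> cmod (\<Sum>j\<le>n. a j \<omega> * v j) \<le> \<gamma> * ?W}"
  proof (rule emeasure_mono)
    show "{\<omega> \<in> space M. cmod (poly (rand_poly n \<omega>) z) \<le> \<alpha> * ?W \<and> cmod (poly (pderiv (rand_poly n \<omega>)) z) \<le> \<beta> * ?W}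
      \<subseteq> {\<omega> \<in> space M. cmod (\<Sum>j\<le>n. a j \<omega> * w j) \<le> \<alpha> * ?W \<and> cmod (\<Sum>j\<le>n. a j \<omega> * v j) \<le> \<gamma> * ?W}"
    proof safe
      fix \<omega> assume 1: "cmod (poly (rand_poly n \<omega>) z) \<le> \<alpha> * ?W" and 2: "cmod (poly (pderiv (rand_poly n \<omega>)) z) \<le> \<beta> * ?W"
      show "cmod (\<Sum>j\<le>n. a j \<omega> * w j) \<le> \<alpha> * ?W" using 1 p by simp
      have "cmod (\<Sum>j\<le>n. a j \<omega> * v j) \<le> cmod z * cmod (poly (pderiv (rand_poly n \<omega>)) z) + m * cmod (poly (rand_poly n \<omega>) z)"
        unfolding q[symmetric] by (rule order_trans[OF norm_triangle_ineq4]) (simp add: norm_mult)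
      also have "\<dots> \<le> 1 / \<rho> * (\<beta> * ?W) + n * (\<alpha> * ?W)"
        using 1 2 z m \<rho> by (intro add_mono mult_mono) auto
      also have "\<dots> = \<gamma> * ?W" by (simp add: \<gamma>_def algebra_simps)
      finally show "cmod (\<Sum>j\<le>n. a j \<omega> * v j) \<le> \<gamma> * ?W" .
    qed
  qed measurable
  also have "\<dots> \<le> ennreal ((\<alpha> * ?W / cmod (w m))\<^sup>2 * (\<gamma> * ?W / cmod (v (Suc m)))\<^sup>2)"
    using m w0 \<alpha> \<gamma> by (intro small_ball_two_linear_forms) (auto simp: v_def)
  also have "\<dots> \<le> ennreal (\<alpha>\<^sup>2 / \<theta> * (\<gamma>\<^sup>2 / \<theta>))"
  proof (intro ennreal_leI mult_mono ratio)
    have "v (Suc m) = w (Suc m)" by (simp add: v_def)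
    then show "(\<gamma> * ?W / cmod (v (Suc m)))\<^sup>2 \<le> \<gamma>\<^sup>2 / \<theta>" using ratio[of "Suc m" \<gamma>] by simp
  qed (use \<theta> in auto)
  finally show ?thesis by (simp add: \<gamma>_def \<theta>_def power2_eq_square)
qed

text \<open>Around a critical point with a small critical value there is a disc of radius \<open>\<eta>\<close> on which both
  the polynomial and its derivative are small, so that the expected area of the set where this happens
  controls the probability.\<close>

lemma prob_small_critical_value:
  assumes n: "n \<ge> 1" and \<rho>: "0 < \<rho>" "\<rho> \<le> 1 / 2" and \<eta>: "0 < \<eta>" "\<eta> \<le> \<rho>" "\<eta> * n \<le> 1" and T: "T \<ge> 0"
  defines "\<beta> \<equiv> \<eta> * hessian_factor n \<rho>"
  defines "\<alpha> \<equiv> T / sqrt ((1 + \<rho>\<^sup>2) ^ n) + \<eta> * \<beta>"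
  obtains B where "B \<in> sets M"
    and "prob B \<le> (1 / (\<eta> * \<rho>))\<^sup>2 * (\<alpha>\<^sup>2 * (\<beta> / \<rho> + n * \<alpha>)\<^sup>2 / (nondegeneracy n \<rho>)\<^sup>2)"
    and "\<And>\<omega> z. \<lbrakk>\<omega> \<in> space M - B; \<forall>j\<le>n. cmod (a j \<omega>) \<le> n; 2 * \<rho> \<le> cmod z; cmod z \<le> 1 / (2 * \<rho>);
       poly (pderiv (rand_poly n \<omega>)) z = 0\<rbrakk> \<Longrightarrow> cmod (poly (rand_poly n \<omega>) z) > T"
proof -
  interpret L: pair_sigma_finite M "lborel :: complex measure" ..
  have \<beta>0: "\<beta> \<ge> 0" using \<eta> by (simp add: \<beta>_def hessian_factor_def)
  have \<alpha>0: "\<alpha> \<ge> 0" using \<eta> T \<beta>0 by (simp add: \<alpha>_def)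
  define Q where "Q = \<alpha>\<^sup>2 * (\<beta> / \<rho> + n * \<alpha>)\<^sup>2 / (nondegeneracy n \<rho>)\<^sup>2"
  have Q0: "Q \<ge> 0" by (simp add: Q_def)
  define A where "A = {z. \<rho> \<le> cmod z \<and> cmod z \<le> 1 / \<rho>}"
  have [measurable]: "A \<in> sets borel" unfolding A_def by measurable
  define E where "E = {x \<in> space (M \<Otimes>\<^sub>M borel). snd x \<in> A \<and>
      cmod (poly (rand_poly n (fst x)) (snd x)) \<le> \<alpha> * fs_weight n (snd x) \<and>
      cmod (poly (pderiv (rand_poly n (fst x))) (snd x)) \<le> \<beta> * fs_weight n (snd x)}"
  have "E \<in> sets (M \<Otimes>\<^sub>M borel)"
    unfolding E_def poly_su2_poly poly_pderiv_su2_poly fs_weight_def by measurable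
  then have [measurable]: "E \<in> sets (M \<Otimes>\<^sub>M lborel)"
    by (simp cong: sets_pair_measure_cong)
  \<comment> \<open>The area of the set of points in the annulus where both the polynomial and its
    derivative are small.\<close>
  define H where "H \<omega> = (\<integral>\<^sup>+z. indicator E (\<omega>, z) \<partial>lborel)" for \<omega>
  have [measurable]: "H \<in> borel_measurable M" unfolding H_def by measurable
  \<comment> \<open>The exceptional event: the area reaches that of a disc of radius \<eta>.
    Markov's inequality bounds its probability by the expected area, which Fubini turns into
    probabilities at fixed points.\<close>
  define B where "B = {\<omega> \<in> space M. 1 \<le> ennreal (1 / (pi * \<eta>\<^sup>2)) * H \<omega>}"
  have B: "B \<in> sets M" unfolding B_def by measurable
  have "(\<integral>\<^sup>+\<omega>. H \<omega> \<partial>M) = (\<integral>\<^sup>+z. (\<integral>\<^sup>+\<omega>. indicator E (\<omega>, z) \<partial>M) \<partial>lborel)"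
    unfolding H_def by (rule L.Fubini'[symmetric]) measurable
  also have "\<dots> \<le> (\<integral>\<^sup>+z. ennreal Q * indicator A z \<partial>lborel)"
  proof (rule nn_integral_mono)
    fix z :: complex
    have "(\<integral>\<^sup>+\<omega>. indicator E (\<omega>, z) \<partial>M) = (\<integral>\<^sup>+\<omega>. indicator {\<omega> \<in> space M. (\<omega>, z) \<in> E} \<omega> \<partial>M)"
      by (intro nn_integral_cong) (auto split: split_indicator)
    also have "\<dots> = emeasure M {\<omega> \<in> space M. (\<omega>, z) \<in> E}" by (rule nn_integral_indicator) measurable
    also have "\<dots> \<le> ennreal Q * indicator A z"
    proof (cases "z \<in> A")
      case True
      then have "{\<omega> \<in> space M. (\<omega>, z) \<in> E} = {\<omega> \<in> space M. cmod (poly (rand_poly n \<omega>) z) \<le> \<alpha> * fs_weight n z \<and>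
        cmod (poly (pderiv (rand_poly n \<omega>)) z) \<le> \<beta> * fs_weight n z}"
        by (auto simp: E_def space_pair_measure)
      then show ?thesis
        using prob_small_value_and_derivative[OF n \<rho>(1) _ _ \<alpha>0 \<beta>0, of z] True by (simp add: A_def Q_def)
    qed (simp add: E_def)
    finally show "(\<integral>\<^sup>+\<omega>. indicator E (\<omega>, z) \<partial>M) \<le> ennreal Q * indicator A z" .
  qed
  also have "\<dots> = ennreal Q * emeasure lborel A" by (subst nn_integral_cmult_indicator) auto
  also have "\<dots> \<le> ennreal Q * emeasure lborel (cball (0 :: complex) (1 / \<rho>))"
    by (intro mult_left_mono emeasure_mono) (auto simp: A_def)
  also have "\<dots> = ennreal Q * ennreal (pi * (1 / \<rho>)\<^sup>2)"
    using \<rho> by (subst emeasure_lborel_cball_complex) auto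
  also have "\<dots> = ennreal (Q * (pi * (1 / \<rho>)\<^sup>2))" using Q0 by (simp add: ennreal_mult')
  finally have intH: "(\<integral>\<^sup>+\<omega>. H \<omega> \<partial>M) \<le> ennreal (Q * (pi * (1 / \<rho>)\<^sup>2))" .
  have "emeasure M B \<le> ennreal (1 / (pi * \<eta>\<^sup>2)) * (\<integral>\<^sup>+\<omega>. H \<omega> * indicator (space M) \<omega> \<partial>M)"
    unfolding B_def by (rule nn_integral_Markov_inequality) measurable
  also have "(\<integral>\<^sup>+\<omega>. H \<omega> * indicator (space M) \<omega> \<partial>M) = (\<integral>\<^sup>+\<omega>. H \<omega> \<partial>M)"
    by (intro nn_integral_cong) auto
  also have "ennreal (1 / (pi * \<eta>\<^sup>2)) * (\<integral>\<^sup>+\<omega>. H \<omega> \<partial>M) \<le> ennreal (1 / (pi * \<eta>\<^sup>2)) * ennreal (Q * (pi * (1 / \<rho>)\<^sup>2))"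
    by (intro mult_left_mono intH) simp
  also have "\<dots> = ennreal (1 / (pi * \<eta>\<^sup>2) * (Q * (pi * (1 / \<rho>)\<^sup>2)))"
    by (rule ennreal_mult'[symmetric]) simp
  also have "1 / (pi * \<eta>\<^sup>2) * (Q * (pi * (1 / \<rho>)\<^sup>2)) = (1 / (\<eta> * \<rho>))\<^sup>2 * Q"
    by (simp add: power_mult_distrib power_divide)
  finally have "prob B \<le> (1 / (\<eta> * \<rho>))\<^sup>2 * Q"
    using Q0 by (simp add: emeasure_eq_measure)
  moreover have "cmod (poly (rand_poly n \<omega>) z) > T"
    if \<omega>: "\<omega> \<in> space M - B" and c: "\<forall>j\<le>n. cmod (a j \<omega>) \<le> n" and z: "2 * \<rho> \<le> cmod z" "cmod z \<le> 1 / (2 * \<rho>)"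
      and crit: "poly (pderiv (rand_poly n \<omega>)) z = 0" for \<omega> z
  proof (rule ccontr)
    assume "\<not> cmod (poly (rand_poly n \<omega>) z) > T"
    then have le: "cmod (poly (rand_poly n \<omega>) z) \<le> T" by simp
    have sub: "(\<omega>, y) \<in> E" if y: "y \<in> cball z \<eta>" for y
    proof -
      have yz: "cmod (y - z) \<le> \<eta>" using y by (simp add: dist_norm norm_minus_commute)
      have y1: "\<rho> \<le> cmod y" using norm_triangle_ineq2[of z y] yz z \<eta> by (simp add: norm_minus_commute)
      have "cmod y \<le> 1 / (2 * \<rho>) + \<rho>" using norm_triangle_ineq[of "y - z" z] yz z \<eta> by simp
      also have "\<dots> \<le> 1 / \<rho>"
      proof -
        have "\<rho> * \<rho> \<le> 1 / 2 * (1 / 2)" using \<rho> by (intro mult_mono) auto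
        then show ?thesis using \<rho> by (simp add: field_simps)
      qed
      finally have y2: "cmod y \<le> 1 / \<rho>" .
      note small = small_near_critical_point[of n "\<lambda>j. a j \<omega>" \<rho> z \<eta> T y, OF c z(1) \<rho>(1) \<eta>(2,3) n _ crit le yz]
      \<comment> \<open>For |y| \<ge> \<rho> the weight is at least this root, so the absolute bound
        \<open>T\<close> becomes the relative one that forms the first summand of \<alpha>.\<close>
      have "sqrt ((1 + \<rho>\<^sup>2) ^ n) \<le> fs_weight n y"
        unfolding fs_weight_def using y1 \<rho> by (intro real_sqrt_le_mono power_mono add_left_mono) auto
      moreover have r0: "0 < sqrt ((1 + \<rho>\<^sup>2) ^ n)" by (simp add: add_pos_nonneg)
      ultimately have "T * 1 \<le> T * (fs_weight n y / sqrt ((1 + \<rho>\<^sup>2) ^ n))"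
        using T by (intro mult_left_mono) auto
      then have "T + \<eta>\<^sup>2 * (hessian_factor n \<rho> * fs_weight n y) \<le> \<alpha> * fs_weight n y"
        by (simp add: \<alpha>_def \<beta>_def power2_eq_square algebra_simps)
      then show ?thesis
        using small y1 y2 \<omega> \<eta> by (auto simp: E_def A_def space_pair_measure \<beta>_def mult_ac)
    qed
    have "ennreal (pi * \<eta>\<^sup>2) = (\<integral>\<^sup>+y. indicator (cball z \<eta>) y \<partial>lborel)"
      using \<eta> by (simp add: emeasure_lborel_cball_complex)
    also have "\<dots> \<le> H \<omega>"
      unfolding H_def using sub by (intro nn_integral_mono) (auto split: split_indicator)
    finally have "ennreal (1 / (pi * \<eta>\<^sup>2)) * ennreal (pi * \<eta>\<^sup>2) \<le> ennreal (1 / (pi * \<eta>\<^sup>2)) * H \<omega>"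
      by (rule mult_left_mono) simp
    then have "1 \<le> ennreal (1 / (pi * \<eta>\<^sup>2)) * H \<omega>"
      using \<eta> by (simp flip: ennreal_mult')
    then show False using \<omega> by (simp add: B_def)
  qed
  ultimately show ?thesis using that B by (auto simp: Q_def)
qed

lemma prob_not_tame:
  assumes n: "n \<ge> 1"
  shows "{\<omega> \<in> space M. \<not> tame_coeffs (\<lambda>j. a j \<omega>) n} \<in> sets M"
    and "prob {\<omega> \<in> space M. \<not> tame_coeffs (\<lambda>j. a j \<omega>) n} \<le> (real n + 1) * (2 * exp (- (real n)\<^sup>2 / 2)) + 2 * (1 / real n)\<^sup>2"
proof -
  show meas: "{\<omega> \<in> space M. \<not> tame_coeffs (\<lambda>j. a j \<omega>) n} \<in> sets M"
    unfolding tame_coeffs_def by measurable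
  let ?G = "\<lambda>j. {\<omega> \<in> space M. cmod (a j \<omega>) > n}" and ?S = "\<lambda>j. {\<omega> \<in> space M. cmod (a j \<omega>) \<le> 1 / real n}"
  have "prob {\<omega> \<in> space M. \<not> tame_coeffs (\<lambda>j. a j \<omega>) n} \<le> prob ((\<Union>j\<in>{..n}. ?G j) \<union> (?S 1 \<union> ?S n))"
    by (rule finite_measure_mono) (auto simp: tame_coeffs_def not_le)
  also have "\<dots> \<le> prob (\<Union>j\<in>{..n}. ?G j) + prob (?S 1 \<union> ?S n)"
    by (rule measure_Un_le) auto
  also have "\<dots> \<le> (\<Sum>j\<le>n. prob (?G j)) + (prob (?S 1) + prob (?S n))"
    by (intro add_mono finite_measure_subadditive_finite measure_Un_le) auto
  also have "\<dots> \<le> (\<Sum>j\<le>n. 2 * exp (- (real n)\<^sup>2 / 2)) + ((1 / real n)\<^sup>2 + (1 / real n)\<^sup>2)"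
    by (intro add_mono sum_mono prob_a_gt prob_a_le) auto
  finally show "prob {\<omega> \<in> space M. \<not> tame_coeffs (\<lambda>j. a j \<omega>) n} \<le> (real n + 1) * (2 * exp (- (real n)\<^sup>2 / 2)) + 2 * (1 / real n)\<^sup>2"
    by (simp add: add.commute)
qed

section \<open>Almost sure simplicity of the critical points\<close>

definition deriv_tail :: "nat \<Rightarrow> (nat \<Rightarrow> complex) \<Rightarrow> complex poly" where
  "deriv_tail n y = (\<Sum>j\<in>{2..n}. monom (of_nat j * (y j * su2_weight n j)) (j - 1))"

lemma pderiv_rand_poly_split:
  assumes "n \<ge> 1"
  shows "pderiv (rand_poly n \<omega>) = [:a 1 \<omega> * su2_weight n 1:] + deriv_tail n (\<lambda>j\<in>{2..n}. a j \<omega>)"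
proof -
  have "{..n} = insert 0 (insert 1 {2..n})" using assms by auto
  then show ?thesis
    by (simp add: su2_poly_def pderiv_add pderiv_sum pderiv_monom pderiv_pCons deriv_tail_def monom_0)
qed

text \<open>Given the coefficients of index at least 2, a double critical point forces \<open>a 1\<close> into a finite set.
  The event is measurable because, by compactness, it suffices to test a countable dense set of points.\<close>

lemma AE_rsquarefree_pderiv:
  assumes n: "n \<ge> 1"
  shows "AE \<omega> in M. rsquarefree (pderiv (rand_poly n \<omega>))"
proof -
  let ?J = "{2..n}"
  let ?N = "PiM ?J (\<lambda>_. borel :: complex measure)"
  define b :: complex where "b = su2_weight n 1"
  have b0: "b \<noteq> 0" using n by (simp add: b_def)
  \<comment> \<open>A sum of two moduli, so that a double root of p_n' is a zero of one continuous
    nonnegative function; \<open>x\<close> stands for \<open>a 1\<close> and does not enter the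
    second summand.\<close>
  define F :: "complex \<Rightarrow> (nat \<Rightarrow> complex) \<Rightarrow> complex \<Rightarrow> real" where
    "F x y z = cmod (x * b + poly (deriv_tail n y) z) + cmod (poly (pderiv (deriv_tail n y)) z)" for x y z
  have F0: "F x y z \<ge> 0" for x y z by (simp add: F_def)
  have contF: "continuous_on S (F x y)" for S x y unfolding F_def by (intro continuous_intros)
  \<comment> \<open>Discs of integer radius exhaust the plane and supply the compactness.\<close>
  define double where "double K = {xy \<in> space (borel \<Otimes>\<^sub>M ?N). \<exists>z\<in>cball 0 (real K). F (fst xy) (snd xy) z = 0}" for K :: nat
  have meas: "double K \<in> sets (borel \<Otimes>\<^sub>M ?N)" for K
  proof -
    obtain D :: "complex set" where D: "countable D" "D \<subseteq> cball 0 (real K)" "cball 0 (real K) \<subseteq> closure D"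
      using separable by blast
    have "(\<exists>z\<in>cball 0 (real K). F x y z = 0) \<longleftrightarrow> (\<forall>m::nat. \<exists>z\<in>D. F x y z < 1 / Suc m)" for x y
    proof safe
      fix z and m :: nat assume z: "z \<in> cball 0 (real K)" "F x y z = 0"
      have "isCont (F x y) z" using contF[of UNIV x y] by (simp add: continuous_on_eq_continuous_at)
      then obtain d where d: "d > 0" "\<And>u. dist u z < d \<Longrightarrow> dist (F x y u) (F x y z) < 1 / Suc m"
        unfolding continuous_at_eps_delta by (metis of_nat_0_less_iff zero_less_Suc zero_less_divide_1_iff)
      obtain u where "u \<in> D" "dist u z < d"
        using z D d by (meson closure_approachable subsetD)
      then have "F x y u < 1 / Suc m" using d(2)[of u] z by (simp add: dist_real_def)
      then show "\<exists>z\<in>D. F x y z < 1 / Suc m" using \<open>u \<in> D\<close> by blast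
    next
      assume dense: "\<forall>m::nat. \<exists>z\<in>D. F x y z < 1 / Suc m"
      obtain z where z: "z \<in> cball 0 (real K)" "\<And>u. u \<in> cball 0 (real K) \<Longrightarrow> F x y z \<le> F x y u"
        using continuous_attains_inf[of "cball 0 (real K)" "F x y"] contF by auto
      have "F x y z \<le> 0"
      proof (rule ccontr)
        assume "\<not> F x y z \<le> 0"
        then obtain m where "1 / Suc m < F x y z" by (metis nat_approx_posE not_le)
        moreover obtain u where "u \<in> D" "F x y u < 1 / Suc m" using dense by blast
        ultimately show False using z(2)[of u] D(2) by fastforce
      qed
      then show "\<exists>z\<in>cball 0 (real K). F x y z = 0" using z F0[of x y z] by (intro bexI[of _ z]) auto
    qed
    then have "double K = {xy \<in> space (borel \<Otimes>\<^sub>M ?N). \<forall>m::nat. \<exists>z\<in>D. F (fst xy) (snd xy) z < 1 / Suc m}"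
      by (simp add: double_def)
    also have "\<dots> \<in> sets (borel \<Otimes>\<^sub>M ?N)"
      using D(1) unfolding F_def deriv_tail_def pderiv_sum pderiv_monom poly_sum poly_monom
      by measurable
    finally show ?thesis .
  qed
  have "AE \<omega> in M. \<forall>K. (a 1 \<omega>, \<lambda>j\<in>?J. a j \<omega>) \<notin> double K"
  proof (subst AE_all_countable, intro allI)
    fix K
    have "emeasure M {\<omega> \<in> space M. (a 1 \<omega>, \<lambda>j\<in>?J. a j \<omega>) \<in> double K}
      \<le> 0 * emeasure M {\<omega> \<in> space M. (\<lambda>j\<in>?J. a j \<omega>) \<in> space ?N}"
    proof (rule emeasure_coeff_rest_le[OF _ meas])
      fix y
      let ?h = "deriv_tail n y"
      have "countable ((\<lambda>z. - poly ?h z / b) ` {z. poly (pderiv ?h) z = 0})"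
      \<comment> \<open>A zero derivative vanishes on the whole plane, but then the polynomial is
        constant and the image is a single point.\<close>
      proof (cases "pderiv ?h = 0")
        case True
        then obtain k where "?h = [:k:]" by (metis degree_eq_zeroE pderiv_eq_0_iff)
        then have "(\<lambda>z. - poly ?h z / b) ` {z. poly (pderiv ?h) z = 0} \<subseteq> {- k / b}" by auto
        then show ?thesis by (rule countable_subset) simp
      qed (simp add: poly_roots_finite countable_finite)
      moreover have "{x. (x, y) \<in> double K} \<subseteq> (\<lambda>z. - poly ?h z / b) ` {z. poly (pderiv ?h) z = 0}"
      proof
        fix x assume "x \<in> {x. (x, y) \<in> double K}"
        then obtain z where "F x y z = 0" by (auto simp: double_def)
        then have "x * b + poly ?h z = 0" "poly (pderiv ?h) z = 0"
          using norm_ge_zero[of "x * b + poly ?h z"] norm_ge_zero[of "poly (pderiv ?h) z"]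
          unfolding F_def by (simp_all add: add_nonneg_eq_0_iff)
        then show "x \<in> (\<lambda>z. - poly ?h z / b) ` {z. poly (pderiv ?h) z = 0}"
          using b0 by (intro image_eqI[of _ _ z]) (auto simp: field_simps eq_neg_iff_add_eq_0)
      qed
      ultimately have "countable {x. (x, y) \<in> double K}" by (rule countable_subset[rotated])
      then show "emeasure (distr M borel (a 1)) {x. (x, y) \<in> double K} \<le> 0 * indicator (space ?N) y"
        by (simp only: emeasure_distr_a_countable) simp
    qed auto
    then have "emeasure M {\<omega> \<in> space M. (a 1 \<omega>, \<lambda>j\<in>?J. a j \<omega>) \<in> double K} = 0" by simp
    moreover have "{\<omega> \<in> space M. (a 1 \<omega>, \<lambda>j\<in>?J. a j \<omega>) \<in> double K} \<in> sets M"
      using meas[of K] by measurable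
    ultimately show "AE \<omega> in M. (a 1 \<omega>, \<lambda>j\<in>?J. a j \<omega>) \<notin> double K"
      by (intro AE_I[of _ _ "{\<omega> \<in> space M. (a 1 \<omega>, \<lambda>j\<in>?J. a j \<omega>) \<in> double K}"]) auto
  qed
  then show ?thesis
  proof (eventually_elim)
    fix \<omega> assume nd: "\<forall>K. (a 1 \<omega>, \<lambda>j\<in>?J. a j \<omega>) \<notin> double K"
    show "rsquarefree (pderiv (rand_poly n \<omega>))"
      unfolding rsquarefree_roots
    proof (intro allI notI)
      fix z assume z: "poly (pderiv (rand_poly n \<omega>)) z = 0 \<and> poly (pderiv (pderiv (rand_poly n \<omega>))) z = 0"
      obtain K :: nat where "cmod z \<le> K" using real_arch_simple by blast
      then have "(a 1 \<omega>, \<lambda>j\<in>?J. a j \<omega>) \<in> double K"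
        using z unfolding pderiv_rand_poly_split[OF n]
        by (auto simp: double_def F_def b_def pderiv_add pderiv_pCons space_pair_measure space_PiM intro!: bexI[of _ z])
      then show False using nd by blast
    qed
  qed
qed

end

text \<open>The rate c is half of that in sqrt((1 + \<rho>^2)^n) = e^(2cn), so the critical value
  contributes only 2 e^(-cn) to \<alpha>. Otherwise \<beta> is of order n^(-2), \<alpha> of order
  n^(-8) and \<open>nondegeneracy\<close> of order n^(-2), which gives n^12 * n^(-16) * n^(-4) * n^4
  = n^(-4). With \<eta> = n^(-k) the order is n^(20-4k), so 6 is the first integer exponent that
  works.\<close>

lemma small_critical_value_bound_tendsto_0:
  fixes \<rho> :: real
  assumes \<rho>: "\<rho> > 0"
  defines "c \<equiv> ln (1 + \<rho>\<^sup>2) / 4"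
  defines "\<eta> \<equiv> \<lambda>n :: nat. 1 / real n ^ 6"
  defines "\<beta> \<equiv> \<lambda>n :: nat. \<eta> n * hessian_factor n \<rho>"
  defines "\<alpha> \<equiv> \<lambda>n :: nat. 2 * exp (c * real n) / sqrt ((1 + \<rho>\<^sup>2) ^ n) + \<eta> n * \<beta> n"
  shows "(\<lambda>n. (1 / (\<eta> n * \<rho>))\<^sup>2 * ((\<alpha> n)\<^sup>2 * (\<beta> n / \<rho> + real n * \<alpha> n)\<^sup>2 / (nondegeneracy n \<rho>)\<^sup>2)) \<longlonglongrightarrow> 0"
proof -
  have c: "c > 0" using \<rho> by (simp add: c_def ln_gt_zero)
  have "2 * exp (c * n) / sqrt ((1 + \<rho>\<^sup>2) ^ n) = 2 * exp (- c * n)" for n :: nat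
  proof -
    have pos: "1 + \<rho>\<^sup>2 > 0" by (simp add: add_pos_nonneg)
    then have "(1 + \<rho>\<^sup>2) ^ n = exp (ln (1 + \<rho>\<^sup>2)) ^ n" by simp
    also have "\<dots> = (exp (2 * c * n))\<^sup>2"
      by (simp add: c_def exp_of_nat_mult[symmetric] power2_eq_square mult_exp_exp mult_ac)
    finally have "sqrt ((1 + \<rho>\<^sup>2) ^ n) = exp (2 * c * n)" by simp
    moreover have "exp (c * n) / exp (2 * c * n) = exp (- c * n)"
      unfolding exp_diff[symmetric] by (simp add: algebra_simps)
    ultimately show ?thesis by (simp only: times_divide_eq_right[symmetric])
  qed
  then have \<alpha>: "\<alpha> = (\<lambda>n. 2 * exp (- c * n) + \<eta> n * \<beta> n)" by (simp add: \<alpha>_def)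
  \<comment> \<open>The number \<open>exp 3\<close> is generalised to a positive parameter
    \<open>e\<close>, since its value does not affect the limit.\<close>
  have "(\<lambda>n. (1 / (1 / real n ^ 6 * \<rho>))\<^sup>2 *
     ((2 * exp (- c * n) + 1 / real n ^ 6 * (1 / real n ^ 6 * ((real n + 1) * (n ^ 3 * e / \<rho>\<^sup>2))))\<^sup>2 *
      (1 / real n ^ 6 * ((real n + 1) * (n ^ 3 * e / \<rho>\<^sup>2)) / \<rho> +
        n * (2 * exp (- c * n) + 1 / real n ^ 6 * (1 / real n ^ 6 * ((real n + 1) * (n ^ 3 * e / \<rho>\<^sup>2)))))\<^sup>2
      / (\<rho>\<^sup>2 / (real n * (real n + 1)))\<^sup>2)) \<longlonglongrightarrow> 0" if "e > 0" for e :: real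
    using c \<rho> that by real_asymp
  from this[of "exp 3"] show ?thesis
    unfolding \<alpha> \<beta>_def \<eta>_def hessian_factor_def nondegeneracy_def by simp
qed

section \<open>The event on which critical points and critical values are controlled\<close>

context gaussian_coeffs
begin

text \<open>\<tau> is the tolerated proportion of lost critical points. Each of the two regions
  outside the annulus costs \<tau> n, hence \<open>2 * \<tau> * n\<close> for small values; large
  values occur only beyond the outer circle, hence \<open>\<tau> * n\<close>. The factor 2 before
  \<open>exp (c * n)\<close> leaves room for the width of the cutoff.\<close>

lemma eventually_good_event:
  fixes \<tau> :: real
  assumes \<tau>: "\<tau> > 0"
  obtains c C :: real and r :: "nat \<Rightarrow> real" where "c > 0" "r \<longlonglongrightarrow> 0"
    "\<forall>\<^sub>F n in sequentially. \<exists>B\<in>sets M. prob B \<le> r n \<and> (\<forall>\<omega>\<in>space M - B.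
        card {z. poly (pderiv (rand_poly n \<omega>)) z = 0} = n - 1 \<and>
        card {z. poly (pderiv (rand_poly n \<omega>)) z = 0 \<and> cmod (poly (rand_poly n \<omega>) z) \<le> 2 * exp (c * n)} \<le> 2 * \<tau> * n \<and>
        card {z. poly (pderiv (rand_poly n \<omega>)) z = 0 \<and> cmod (poly (rand_poly n \<omega>) z) > exp (C * n)} \<le> \<tau> * n)"
proof -
  \<comment> \<open>Chosen so that \<open>ln (1 / \<delta>) = 5 / \<tau>\<close>, which turns the
    bound 5n into at most \<tau> n critical points.\<close>
  define \<delta> where "\<delta> = exp (- 5 / \<tau>)"
  \<comment> \<open>The estimate on critical values covers 2 \<rho> \<le> |z| \<le> 1 / (2 \<rho>),
    which now is the annulus of \<delta>.\<close>
  define \<rho> where "\<rho> = \<delta> / 2"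
  have \<delta>: "0 < \<delta>" "\<delta> \<le> 1" "ln (1 / \<delta>) = 5 / \<tau>" using \<tau> by (auto simp: \<delta>_def ln_div)
  have \<rho>: "0 < \<rho>" "\<rho> \<le> 1 / 2" using \<delta> by (auto simp: \<rho>_def)
  define c where "c = ln (1 + \<rho>\<^sup>2) / 4"
  \<comment> \<open>The 2 absorbs the factors n and n + 1, each at most e^n; the logarithm comes
    from the weight at |z| \<le> 1/\<delta>, whose square root is dropped.\<close>
  define C where "C = 2 + ln (1 + 1 / \<delta>\<^sup>2)"
  define r3 where "r3 = (\<lambda>n. let \<eta> = 1 / real n ^ 6; \<beta> = \<eta> * hessian_factor n \<rho>;
      \<alpha> = 2 * exp (c * n) / sqrt ((1 + \<rho>\<^sup>2) ^ n) + \<eta> * \<beta> in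
      (1 / (\<eta> * \<rho>))\<^sup>2 * (\<alpha>\<^sup>2 * (\<beta> / \<rho> + n * \<alpha>)\<^sup>2 / (nondegeneracy n \<rho>)\<^sup>2))"
  define r where "r n = r3 n + ((real n + 1) * (2 * exp (- (real n)\<^sup>2 / 2)) + 2 * (1 / real n)\<^sup>2)" for n
  have r: "r \<longlonglongrightarrow> 0"
  proof -
    have "r3 \<longlonglongrightarrow> 0"
      using small_critical_value_bound_tendsto_0[OF \<rho>(1)] by (simp add: r3_def c_def Let_def)
    moreover have "(\<lambda>n. (real n + 1) * (2 * exp (- (real n)\<^sup>2 / 2)) + 2 * (1 / real n)\<^sup>2) \<longlonglongrightarrow> 0"
      by real_asymp
    ultimately have "(\<lambda>n. r3 n + ((real n + 1) * (2 * exp (- (real n)\<^sup>2 / 2)) + 2 * (1 / real n)\<^sup>2)) \<longlonglongrightarrow> 0 + 0"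
      by (rule tendsto_add)
    then show ?thesis by (simp add: r_def[abs_def])
  qed
  have "\<forall>\<^sub>F n in sequentially. n \<ge> 2 \<and> 1 / real n ^ 6 \<le> \<rho> \<and> 1 / real n ^ 6 * n \<le> 1"
  proof (intro eventually_conj)
    show "\<forall>\<^sub>F n in sequentially. n \<ge> (2 :: nat)" by (rule eventually_ge_at_top)
    show "\<forall>\<^sub>F n in sequentially. 1 / real n ^ 6 \<le> \<rho>" using \<rho>(1) by real_asymp
    show "\<forall>\<^sub>F n in sequentially. 1 / real n ^ 6 * n \<le> 1" by real_asymp
  qed
  then have "\<forall>\<^sub>F n in sequentially. \<exists>B\<in>sets M. prob B \<le> r n \<and> (\<forall>\<omega>\<in>space M - B.
        card {z. poly (pderiv (rand_poly n \<omega>)) z = 0} = n - 1 \<and>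
        card {z. poly (pderiv (rand_poly n \<omega>)) z = 0 \<and> cmod (poly (rand_poly n \<omega>) z) \<le> 2 * exp (c * n)} \<le> 2 * \<tau> * n \<and>
        card {z. poly (pderiv (rand_poly n \<omega>)) z = 0 \<and> cmod (poly (rand_poly n \<omega>) z) > exp (C * n)} \<le> \<tau> * n)"
  proof eventually_elim
    case (elim n)
    then have n: "n \<ge> 2" "n \<ge> 1" and \<eta>: "1 / real n ^ 6 \<le> \<rho>" "1 / real n ^ 6 * n \<le> 1" "0 < 1 / real n ^ 6" by auto
    have T: "2 * exp (c * n) \<ge> 0" by simp
    obtain B3 where B3: "B3 \<in> sets M" "prob B3 \<le> r3 n"
      and large: "\<And>\<omega> z. \<lbrakk>\<omega> \<in> space M - B3; \<forall>j\<le>n. cmod (a j \<omega>) \<le> n; 2 * \<rho> \<le> cmod z; cmod z \<le> 1 / (2 * \<rho>);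
       poly (pderiv (rand_poly n \<omega>)) z = 0\<rbrakk> \<Longrightarrow> cmod (poly (rand_poly n \<omega>) z) > 2 * exp (c * n)"
      using prob_small_critical_value[OF n(2) \<rho> \<eta>(3) \<eta>(1,2) T] by (auto simp: r3_def Let_def)
    obtain B1 where B1: "B1 \<in> null_sets M" and sf: "\<And>\<omega>. \<omega> \<in> space M - B1 \<Longrightarrow> rsquarefree (pderiv (rand_poly n \<omega>))"
      using AE_rsquarefree_pderiv[OF n(2)] by (auto elim!: AE_E3)
    define B2 where "B2 = {\<omega> \<in> space M. \<not> tame_coeffs (\<lambda>j. a j \<omega>) n}"
    note B2 = prob_not_tame[OF n(2), folded B2_def]
    show ?case
    proof (intro bexI[of _ "B3 \<union> B2 \<union> B1"] conjI ballI)
      show "B3 \<union> B2 \<union> B1 \<in> sets M" using B1 B2 B3 by auto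
      have "prob (B3 \<union> B2 \<union> B1) \<le> prob B3 + prob B2 + prob B1"
        using B1 B2 B3 by (intro order_trans[OF measure_Un_le] add_mono measure_Un_le) auto
      also have "prob B1 = 0" using B1 by (simp add: measure_eq_0_null_sets)
      finally show "prob (B3 \<union> B2 \<union> B1) \<le> r n" using B2(2) B3(2) by (simp add: r_def)
    next
      fix \<omega> assume \<omega>: "\<omega> \<in> space M - (B3 \<union> B2 \<union> B1)"
      let ?p = "rand_poly n \<omega>"
      have tame: "tame_coeffs (\<lambda>j. a j \<omega>) n" using \<omega> by (auto simp: B2_def)
      then have cle: "\<forall>j\<le>n. cmod (a j \<omega>) \<le> n" and cn: "1 / n \<le> cmod (a n \<omega>)" by (auto simp: tame_coeffs_def)
      have "0 < 1 / real n" using n by simp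
      then have an: "a n \<omega> \<noteq> 0" using cn by auto
      note deg = degree_pderiv_su2_poly[of n "\<lambda>j. a j \<omega>", OF n(2) an]
      have fin: "finite {z. poly (pderiv ?p) z = 0 \<and> Q z}" for Q
        using poly_roots_finite[OF deg(3)] by (rule rev_finite_subset) auto
      show "card {z. poly (pderiv ?p) z = 0} = n - 1"
        using card_roots_rsquarefree[OF sf, of \<omega>] \<omega> deg(1) by simp
      let ?near = "{z. poly (pderiv ?p) z = 0 \<and> cmod z < \<delta>}" and ?far = "{z. poly (pderiv ?p) z = 0 \<and> cmod z > 1 / \<delta>}"
      have near: "card ?near \<le> \<tau> * n" and far: "card ?far \<le> \<tau> * n"
        using card_critical_points_outside_annulus[OF n(1) tame \<delta>(1,2)] \<tau> by (simp_all add: \<delta>(3) field_simps)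
      have "{z. poly (pderiv ?p) z = 0 \<and> cmod (poly ?p z) \<le> 2 * exp (c * n)} \<subseteq> ?near \<union> ?far"
      proof safe
        fix z assume z: "poly (pderiv ?p) z = 0" "cmod (poly ?p z) \<le> 2 * exp (c * n)" "\<not> cmod z > 1 / \<delta>"
        have "\<omega> \<in> space M - B3" "cmod z \<le> 1 / (2 * \<rho>)" using \<omega> z(3) by (auto simp: \<rho>_def)
        then have "\<not> 2 * \<rho> \<le> cmod z" using large[of \<omega> z] cle z(1,2) by fastforce
        then show "cmod z < \<delta>" by (simp add: \<rho>_def)
      qed
      then have "card {z. poly (pderiv ?p) z = 0 \<and> cmod (poly ?p z) \<le> 2 * exp (c * n)} \<le> card (?near \<union> ?far)"
        by (intro card_mono finite_UnI fin)
      also have "\<dots> \<le> card ?near + card ?far" by (rule card_Un_le)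
      finally show "card {z. poly (pderiv ?p) z = 0 \<and> cmod (poly ?p z) \<le> 2 * exp (c * n)} \<le> 2 * \<tau> * n"
        using near far by simp
      have "{z. poly (pderiv ?p) z = 0 \<and> cmod (poly ?p z) > exp (C * n)} \<subseteq> ?far"
      proof safe
        fix z assume big: "exp (C * n) < cmod (poly ?p z)"
        show "1 / \<delta> < cmod z"
        proof (rule ccontr)
          assume "\<not> 1 / \<delta> < cmod z"
          then have "(cmod z)\<^sup>2 \<le> (1 / \<delta>)\<^sup>2" by (intro power_mono) auto
          then have zle: "1 + (cmod z)\<^sup>2 \<le> 1 + 1 / \<delta>\<^sup>2" by (simp add: power_divide)
          have pos: "1 + 1 / \<delta>\<^sup>2 > 0" by (simp add: add_pos_nonneg)
          have "fs_weight n z \<le> (1 + (cmod z)\<^sup>2) ^ n"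
            unfolding fs_weight_def by (intro real_le_lsqrt self_le_power one_le_power) auto
          also have "\<dots> \<le> (1 + 1 / \<delta>\<^sup>2) ^ n" using zle by (intro power_mono) auto
          also have "\<dots> = exp (ln (1 + 1 / \<delta>\<^sup>2)) ^ n" using pos by simp
          also have "\<dots> = exp (n * ln (1 + 1 / \<delta>\<^sup>2))" by (simp add: exp_of_nat_mult)
          finally have W: "fs_weight n z \<le> exp (n * ln (1 + 1 / \<delta>\<^sup>2))" .
          have e: "real n + 1 \<le> exp n" using exp_ge_add_one_self[of "real n"] by linarith
          then have e': "real n \<le> exp n" by linarith
          have "cmod (poly ?p z) \<le> (real n + 1) * (n * fs_weight n z)"
            by (rule cmod_poly_su2_poly_le[OF cle])
          also have "\<dots> \<le> exp n * (exp n * exp (n * ln (1 + 1 / \<delta>\<^sup>2)))"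
            by (intro mult_mono e e' W) auto
          also have "\<dots> = exp (C * n)" by (simp add: C_def mult_exp_exp algebra_simps)
          finally show False using big by simp
        qed
      qed
      then have "card {z. poly (pderiv ?p) z = 0 \<and> cmod (poly ?p z) > exp (C * n)} \<le> card ?far"
        by (intro card_mono fin)
      then show "card {z. poly (pderiv ?p) z = 0 \<and> cmod (poly ?p z) > exp (C * n)} \<le> \<tau> * n"
        using far by linarith
    qed
  qed
  moreover have "c > 0" using \<rho> by (simp add: c_def ln_gt_zero)
  ultimately show ?thesis using that[OF _ r] by blast
qed

end

subsection \<open>Smooth cutoff functions\<close>

text \<open>Smoothness is split into finite orders so that closure properties follow by induction on
  \<open>k\<close>: the differentiation rules express the first derivative through functions that
  are differentiable \<open>k\<close> more times.\<close>

fun times_differentiable :: "nat \<Rightarrow> (real \<Rightarrow> real) \<Rightarrow> bool" where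
  "times_differentiable 0 f \<longleftrightarrow> True"
| "times_differentiable (Suc k) f \<longleftrightarrow>
     (\<exists>f'. (\<forall>x. (f has_real_derivative f' x) (at x)) \<and> times_differentiable k f')"

lemma times_differentiable_SucD: "times_differentiable (Suc k) f \<Longrightarrow> times_differentiable k f"
proof (induction k arbitrary: f)
  case (Suc k)
  then show ?case by (metis times_differentiable.simps(2))
qed simp

lemma times_differentiable_const: "times_differentiable k (\<lambda>_. c)"
  by (induction k arbitrary: c) (auto intro!: derivative_eq_intros exI[of _ "\<lambda>_. 0"])

lemma times_differentiable_add:
  "times_differentiable k f \<Longrightarrow> times_differentiable k g \<Longrightarrow> times_differentiable k (\<lambda>x. f x + g x)"
proof (induction k arbitrary: f g)
  case (Suc k)
  then obtain f' g' where "\<And>x. (f has_real_derivative f' x) (at x)" "times_differentiable k f'"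
    "\<And>x. (g has_real_derivative g' x) (at x)" "times_differentiable k g'"
    by auto
  then show ?case
    using Suc.IH[of f' g'] by (auto intro!: exI[of _ "\<lambda>x. f' x + g' x"] derivative_eq_intros)
qed simp

lemma times_differentiable_mult:
  "times_differentiable k f \<Longrightarrow> times_differentiable k g \<Longrightarrow> times_differentiable k (\<lambda>x. f x * g x)"
proof (induction k arbitrary: f g)
  case (Suc k)
  then obtain f' g' where d: "\<And>x. (f has_real_derivative f' x) (at x)" "times_differentiable k f'"
    "\<And>x. (g has_real_derivative g' x) (at x)" "times_differentiable k g'"
    by auto
  have "times_differentiable k (\<lambda>x. f' x * g x + f x * g' x)"
    using d Suc.prems[THEN times_differentiable_SucD] by (intro times_differentiable_add Suc.IH)
  then show ?case
    using d by (auto intro!: exI[of _ "\<lambda>x. f' x * g x + f x * g' x"] derivative_eq_intros)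
qed simp

text \<open>The derivative contains \<open>inverse (f x)\<close> itself, to which the induction
  hypothesis applies at the lower order.\<close>

lemma times_differentiable_inverse:
  "times_differentiable k f \<Longrightarrow> (\<And>x. f x \<noteq> 0) \<Longrightarrow> times_differentiable k (\<lambda>x. inverse (f x))"
proof (induction k arbitrary: f)
  case (Suc k)
  then obtain f' where d: "\<And>x. (f has_real_derivative f' x) (at x)" "times_differentiable k f'"
    by auto
  have inv: "times_differentiable k (\<lambda>x. inverse (f x))"
    using Suc times_differentiable_SucD by blast
  have "times_differentiable k (\<lambda>x. (-1) * (inverse (f x) * f' x * inverse (f x)))"
    by (intro times_differentiable_mult times_differentiable_const inv d)
  then show ?case
    using d Suc.prems by (auto intro!: exI[of _ "\<lambda>x. - (inverse (f x) * f' x * inverse (f x))"] DERIV_inverse' )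
qed simp

lemma times_differentiable_affine:
  "times_differentiable k f \<Longrightarrow> times_differentiable k (\<lambda>x. f (c * x + d))"
proof (induction k arbitrary: f)
  case (Suc k)
  then obtain f' where d: "\<And>x. (f has_real_derivative f' x) (at x)" "times_differentiable k f'"
    by auto
  have "times_differentiable k (\<lambda>x. f' (c * x + d) * c)"
    by (intro times_differentiable_mult times_differentiable_const Suc.IH d)
  moreover have "((\<lambda>x. f (c * x + d)) has_real_derivative f' (c * x + d) * c) (at x)" for x
    by (rule DERIV_chain2[OF d(1)]) (auto intro!: derivative_eq_intros)
  ultimately show ?case unfolding times_differentiable.simps(2)
    by (intro exI[of _ "\<lambda>x. f' (c * x + d) * c"] conjI allI)
qed simp

section \<open>Functions that are flat at the origin\<close>

lemma poly_mult_exp_minus_tendsto_0: "((\<lambda>t. poly p t * exp (- t)) \<longlongrightarrow> (0::real)) at_top"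
proof -
  have "((\<lambda>t. \<Sum>i\<le>degree p. coeff p i * (t ^ i / exp t)) \<longlongrightarrow> (\<Sum>i\<le>degree p. coeff p i * 0)) at_top"
    by (intro tendsto_intros tendsto_power_div_exp_0)
  then show ?thesis
    by (simp add: poly_altdef exp_minus sum_distrib_left divide_inverse mult_ac)
qed

text \<open>For \<open>p = 1\<close> this is the classical e^(-1/x). The polynomial in 1/x makes the
  family closed under differentiation: with t = 1/x the derivative of p(t) e^(-t) is t^2 (p - p')(t)
  e^(-t).\<close>

definition flat_fun :: "real poly \<Rightarrow> real \<Rightarrow> real" where
  "flat_fun p x = (if x \<le> 0 then 0 else poly p (1 / x) * exp (- (1 / x)))"

lemma has_derivative_flat_fun:
  "(flat_fun p has_real_derivative flat_fun ([:0, 0, 1:] * (p - pderiv p)) x) (at x)"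
proof -
  consider "x < 0" | "x > 0" | "x = 0" by linarith
  then show ?thesis
  proof cases
    case 1
    have "((\<lambda>_. 0) has_real_derivative 0) (at x)" by simp
    then have "(flat_fun p has_real_derivative 0) (at x)"
      by (rule has_field_derivative_transform_within_open[of _ _ _ "{..<0}"]) (use 1 in \<open>auto simp: flat_fun_def\<close>)
    then show ?thesis using 1 by (simp add: flat_fun_def)
  next
    case 2
    let ?t = "1 / x"
    have t: "((\<lambda>x. 1 / x) has_real_derivative - (?t\<^sup>2)) (at x)"
      using 2 by (auto intro!: derivative_eq_intros simp: power2_eq_square)
    have "((\<lambda>x. poly p (1 / x) * exp (- (1 / x))) has_real_derivative
        poly (pderiv p) ?t * - (?t\<^sup>2) * exp (- ?t) + exp (- ?t) * ?t\<^sup>2 * poly p ?t) (at x)"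
      by (rule derivative_eq_intros DERIV_chain2[OF poly_DERIV t] t refl)+ simp
    then have "((\<lambda>x. poly p (1 / x) * exp (- (1 / x))) has_real_derivative
        flat_fun ([:0, 0, 1:] * (p - pderiv p)) x) (at x)"
      by (rule DERIV_cong) (use 2 in \<open>simp add: flat_fun_def power2_eq_square algebra_simps\<close>)
    then show ?thesis
      by (rule has_field_derivative_transform_within_open[of _ _ _ "{0<..}"]) (use 2 in \<open>auto simp: flat_fun_def\<close>)
  next
    case 3
    \<comment> \<open>With t = 1/h the difference quotient at 0 is t p(t) e^(-t); the extra factor t
      is the shift \<open>pCons 0 p\<close>.\<close>
    have r: "((\<lambda>h. flat_fun p h / h) \<longlongrightarrow> 0) (at_right 0)"
    proof -
      have "((\<lambda>t. poly (pCons 0 p) t * exp (- t)) \<longlongrightarrow> 0) at_top"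
        by (rule poly_mult_exp_minus_tendsto_0)
      moreover have "filterlim (\<lambda>h. 1 / h :: real) at_top (at_right 0)" by real_asymp
      ultimately have "((\<lambda>h. poly (pCons 0 p) (1 / h) * exp (- (1 / h))) \<longlongrightarrow> 0) (at_right 0)"
        by (rule filterlim_compose)
      then show ?thesis
        by (rule Lim_transform_eventually) (auto simp: eventually_at_filter flat_fun_def)
    qed
    have l: "((\<lambda>h. flat_fun p h / h) \<longlongrightarrow> 0) (at_left 0)"
      by (rule Lim_transform_eventually[OF tendsto_const]) (auto simp: eventually_at_filter flat_fun_def)
    have "((\<lambda>h. flat_fun p h / h) \<longlongrightarrow> 0) (at 0)"
      using l r by (simp add: filterlim_at_split)
    then show ?thesis by (simp add: 3 DERIV_def flat_fun_def)
  qed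
qed

lemma times_differentiable_flat_fun: "times_differentiable k (flat_fun p)"
  by (induction k arbitrary: p) (auto intro: has_derivative_flat_fun)

text \<open>The usual quotient going from 1 at \<open>x \<le> 0\<close> to 0 at
  \<open>x \<ge> 1\<close>; the denominator is positive because \<open>x\<close> and
  \<open>1 - x\<close> are never both nonpositive.\<close>

definition smooth_step :: "real \<Rightarrow> real" where
  "smooth_step x = flat_fun 1 (1 - x) * inverse (flat_fun 1 (1 - x) + flat_fun 1 x)"

lemma flat_fun_1: "flat_fun 1 x \<ge> 0" "flat_fun 1 x = 0 \<longleftrightarrow> x \<le> 0"
  by (auto simp: flat_fun_def)

lemma flat_fun_1_add_pos: "flat_fun 1 (1 - x) + flat_fun 1 x > 0"
  using flat_fun_1[of x] flat_fun_1[of "1 - x"] by linarith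

lemma times_differentiable_smooth_step: "times_differentiable k smooth_step"
proof -
  have "times_differentiable k (\<lambda>x. flat_fun 1 ((-1) * x + 1))"
    by (intro times_differentiable_affine times_differentiable_flat_fun)
  then have 1: "times_differentiable k (\<lambda>x. flat_fun 1 (1 - x))" by simp
  show ?thesis unfolding smooth_step_def[abs_def]
    by (intro times_differentiable_mult times_differentiable_inverse times_differentiable_add 1
        times_differentiable_flat_fun flat_fun_1_add_pos[THEN less_imp_neq, THEN not_sym])
qed

lemma smooth_step_range: "0 \<le> smooth_step x" "smooth_step x \<le> 1"
  using flat_fun_1_add_pos[of x] flat_fun_1[of "1 - x"] flat_fun_1(1)[of x]
  by (auto simp: smooth_step_def field_simps)

lemma smooth_step_eq: "x \<le> 0 \<Longrightarrow> smooth_step x = 1" "x \<ge> 1 \<Longrightarrow> smooth_step x = 0"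
  using flat_fun_1[of x] flat_fun_1[of "1 - x"] by (auto simp: smooth_step_def)

text \<open>A test function demands one sequence of successive derivatives, whereas the hypothesis
  gives a separate chain for each order. Uniqueness of derivatives identifies the chains with the
  iterates of \<open>deriv\<close>.\<close>

lemma test_functionI:
  assumes diff: "\<And>k. times_differentiable k f" and zero: "\<And>x. x \<ge> b \<Longrightarrow> f x = 0"
  shows "test_function f"
proof -
  have higher: "\<forall>k. times_differentiable k ((deriv ^^ m) f)" for m
  proof (induction m)
    case (Suc m)
    show ?case
    proof
      fix k
      obtain f' where "\<And>x. ((deriv ^^ m) f has_real_derivative f' x) (at x)" "times_differentiable k f'"
        using Suc[rule_format, of "Suc k"] by auto
      moreover from this(1) have "deriv ((deriv ^^ m) f) = f'" by (auto intro: DERIV_imp_deriv)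
      ultimately show "times_differentiable k ((deriv ^^ Suc m) f)" by simp
    qed
  qed (simp add: diff)
  have "((deriv ^^ m) f has_real_derivative (deriv ^^ Suc m) f x) (at x within {0..})" for m x
  proof -
    obtain f' where "\<And>x. ((deriv ^^ m) f has_real_derivative f' x) (at x)"
      using higher[of m, rule_format, of 1] by auto
    then have "((deriv ^^ m) f has_real_derivative deriv ((deriv ^^ m) f) x) (at x)"
      by (metis DERIV_imp_deriv)
    then show ?thesis by (auto intro: has_field_derivative_at_within)
  qed
  moreover have "compact (closure {x \<in> {0..}. f x \<noteq> 0})"
  proof -
    have "{x \<in> {0..}. f x \<noteq> 0} \<subseteq> {0..b}" using zero by (auto simp: not_le[symmetric] intro: less_imp_le) (meson linear)
    then show ?thesis using bounded_closed_interval bounded_subset compact_closure by blast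
  qed
  ultimately show ?thesis unfolding test_function_def
    by (auto intro!: exI[of _ "\<lambda>m. (deriv ^^ m) f"])
qed

text \<open>The scaling confines the transition to [x, x + 1/(k+1)], so the limit is 1 at the
  endpoint \<open>x\<close>, and the function vanishes from \<open>x + 1\<close> on for every
  \<open>k\<close>. The value 1 on the negative axis is harmless, since supports are taken in
  \<open>{0..}\<close>.\<close>

definition cutoff :: "real \<Rightarrow> nat \<Rightarrow> real \<Rightarrow> real" where
  "cutoff x k y = smooth_step (real (Suc k) * (y - x))"

lemma test_function_cutoff: "test_function (cutoff x k)"
proof (rule test_functionI)
  show "times_differentiable m (cutoff x k)" for m
    using times_differentiable_affine[OF times_differentiable_smooth_step, of m "real (Suc k)" "- (real (Suc k) * x)"]
    by (simp add: cutoff_def[abs_def] algebra_simps)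
  show "cutoff x k y = 0" if "y \<ge> x + 1" for y
    unfolding cutoff_def
  proof (rule smooth_step_eq(2))
    have "1 * 1 \<le> real (Suc k) * (y - x)" using that by (intro mult_mono) auto
    then show "1 \<le> real (Suc k) * (y - x)" by simp
  qed
qed

lemma cutoff_range: "0 \<le> cutoff x k y" "cutoff x k y \<le> 1"
  by (simp_all add: cutoff_def smooth_step_range)

lemma cutoff_eq_1: "y \<le> x \<Longrightarrow> cutoff x k y = 1"
  by (simp add: cutoff_def smooth_step_eq mult_nonneg_nonpos)

lemma cutoff_eq_0:
  assumes "y \<ge> x + 1" shows "cutoff x k y = 0"
proof -
  have "1 * 1 \<le> real (Suc k) * (y - x)" using assms by (intro mult_mono) auto
  then show ?thesis by (simp add: cutoff_def smooth_step_eq)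
qed

lemma cutoff_tendsto: "(\<lambda>k. cutoff x k y) \<longlonglongrightarrow> indicator {..x} y"
proof (cases "y \<le> x")
  case False
  then have "\<forall>\<^sub>F k in sequentially. real (Suc k) * (y - x) \<ge> 1"
    by real_asymp
  then have "\<forall>\<^sub>F k in sequentially. 0 = cutoff x k y"
    by eventually_elim (simp add: cutoff_def smooth_step_eq)
  then show ?thesis using False by (simp add: Lim_transform_eventually[OF tendsto_const])
qed (simp add: cutoff_eq_1)

lemma continuous_cutoff: "continuous_on UNIV (cutoff x k)"
proof -
  have "times_differentiable 1 smooth_step" by (rule times_differentiable_smooth_step)
  then have "continuous_on UNIV smooth_step"
    by (auto intro!: continuous_at_imp_continuous_on intro: DERIV_isCont)
  then show ?thesis unfolding cutoff_def[abs_def]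
    by (auto intro!: continuous_on_compose2[of UNIV smooth_step] continuous_intros)
qed

text \<open>Dominated convergence with |D| on [0, x + 1], where continuity gives integrability;
  neither the sign nor the global integrability of \<open>D\<close> is known here.\<close>

lemma set_lebesgue_integral_cutoff_tendsto:
  assumes cont: "continuous_on {0..} D" and x: "x \<ge> 0"
  shows "(\<lambda>k. LBINT y:{0..}. cutoff x k y * D y) \<longlonglongrightarrow> (LBINT y:{0..x}. D y)"
  unfolding set_lebesgue_integral_def
proof (rule integral_dominated_convergence[where w = "\<lambda>y. indicator {0..x+1} y *\<^sub>R norm (D y)"])
  \<comment> \<open>\<open>D\<close> is arbitrary on the negative axis, so measurability is
    available only after restriction to \<open>{0..}\<close>.\<close>
  have Dm: "(\<lambda>y. indicator {0..} y *\<^sub>R D y) \<in> borel_measurable borel"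
    by (rule borel_measurable_continuous_on_indicator[OF _ cont]) auto
  have [measurable]: "cutoff x k \<in> borel_measurable borel" for k
    by (rule borel_measurable_continuous_onI[OF continuous_cutoff])
  have "(\<lambda>y. indicator {0..x} y *\<^sub>R (indicator {0..} y *\<^sub>R D y)) \<in> borel_measurable lborel"
    using Dm by measurable
  also have "(\<lambda>y. indicator {0..x} y *\<^sub>R (indicator {0..} y *\<^sub>R D y)) = (\<lambda>y. indicator {0..x} y *\<^sub>R D y)"
    by (auto simp: fun_eq_iff split: split_indicator)
  finally show "(\<lambda>y. indicator {0..x} y *\<^sub>R D y) \<in> borel_measurable lborel" .
  show "(\<lambda>y. indicator {0..} y *\<^sub>R (cutoff x k y * D y)) \<in> borel_measurable lborel" for k
  proof -
    have "(\<lambda>y. cutoff x k y * (indicator {0..} y *\<^sub>R D y)) \<in> borel_measurable lborel"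
      using Dm by measurable
    then show ?thesis by (simp add: mult_ac)
  qed
  have "continuous_on {0..x+1} (\<lambda>y. norm (D y))"
    using cont by (intro continuous_intros) (auto intro: continuous_on_subset)
  then show "integrable lborel (\<lambda>y. indicator {0..x+1} y *\<^sub>R norm (D y))"
    using borel_integrable_atLeastAtMost'[of 0 "x+1" "\<lambda>y. norm (D y)"] by (simp add: set_integrable_def)
  show "AE y in lborel. (\<lambda>k. indicator {0..} y *\<^sub>R (cutoff x k y * D y)) \<longlonglongrightarrow> indicator {0..x} y *\<^sub>R D y"
  proof (rule AE_I2)
    fix y :: real
    have "(\<lambda>k. indicator {0..} y *\<^sub>R (cutoff x k y * D y)) \<longlonglongrightarrow> indicator {0..} y *\<^sub>R (indicator {..x} y * D y)"
      by (intro tendsto_intros cutoff_tendsto)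
    then show "(\<lambda>k. indicator {0..} y *\<^sub>R (cutoff x k y * D y)) \<longlonglongrightarrow> indicator {0..x} y *\<^sub>R D y"
      by (auto split: split_indicator_asm split_indicator)
  qed
  show "AE y in lborel. norm (indicator {0..} y *\<^sub>R (cutoff x k y * D y)) \<le> indicator {0..x+1} y *\<^sub>R norm (D y)" for k
  proof (rule AE_I2)
    fix y :: real
    show "norm (indicator {0..} y *\<^sub>R (cutoff x k y * D y)) \<le> indicator {0..x+1} y *\<^sub>R norm (D y)"
      using cutoff_range[of x k y] cutoff_eq_0[of x y k]
      by (auto simp: abs_mult mult_left_le_one_le split: split_indicator)
  qed
qed

subsection \<open>Limits of the distribution function\<close>

text \<open>The first bound uses that the cutoff vanishes from \<open>x + 1\<close> on, the last
  that it is 1 up to \<open>x\<close>. For the zero derivative the index set is the whole plane and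
  the sum defaults to 0; the last claim sets this case apart.\<close>

lemma critical_value_sum_cutoff_le:
  assumes "n \<ge> 2"
  shows "critical_value_sum (su2_poly c n) (cutoff x k)
      \<le> card {z. poly (pderiv (su2_poly c n)) z = 0 \<and> cmod (poly (su2_poly c n) z) \<le> x + 1}"
    and "critical_value_sum (su2_poly c n) (cutoff x k) \<le> real n - 1"
    and "0 \<le> critical_value_sum (su2_poly c n) (cutoff x k)"
    and "card {z. poly (pderiv (su2_poly c n)) z = 0 \<and> cmod (poly (su2_poly c n) z) \<le> x}
      \<le> critical_value_sum (su2_poly c n) (cutoff x k) \<or> pderiv (su2_poly c n) = 0"
proof -
  let ?p = "su2_poly c n"
  let ?Z = "{z. poly (pderiv ?p) z = 0}"
  let ?s = "critical_value_sum ?p (cutoff x k)"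
  have card: "real (card {z. poly (pderiv ?p) z = 0 \<and> Q z}) = (\<Sum>z\<in>?Z. if Q z then 1 else 0)" if "finite ?Z" for Q
    using that by (simp add: sum.If_cases Collect_conj_eq)
  show "0 \<le> ?s" unfolding critical_value_sum_def by (intro sum_nonneg cutoff_range)
  show "?s \<le> card {z. poly (pderiv ?p) z = 0 \<and> cmod (poly ?p z) \<le> x + 1}"
  proof (cases "finite ?Z")
    case True
    then show ?thesis unfolding critical_value_sum_def card[OF True]
      by (intro sum_mono) (auto simp: cutoff_range cutoff_eq_0)
  qed (simp add: critical_value_sum_def)
  have "?s \<le> real (card ?Z) * 1"
    unfolding critical_value_sum_def by (rule sum_bounded_above) (rule cutoff_range)
  also have "\<dots> \<le> real (n - 1)" using card_critical_points_le[where c = c and n = n] by simp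
  finally show "?s \<le> real n - 1" using assms by (simp add: of_nat_diff)
  show "card {z. poly (pderiv ?p) z = 0 \<and> cmod (poly ?p z) \<le> x} \<le> ?s \<or> pderiv ?p = 0"
  proof (cases "pderiv ?p = 0")
    case False
    then have "finite ?Z" by (rule poly_roots_finite)
    then show ?thesis unfolding critical_value_sum_def card[OF \<open>finite ?Z\<close>]
      by (intro disjI1 sum_mono) (auto simp: cutoff_range cutoff_eq_1)
  qed simp
qed

section \<open>The distribution function as a limit of expectations\<close>

context gaussian_coeffs
begin

text \<open>The only place where the defining identity of the expected density enters: integrals of
  cutoffs against \<open>D\<close> become expectations, and their limit is the integral over
  [0, x].\<close>

lemma critical_value_cdf_limit_expectation:
  assumes D: "is_expected_density M a n D" and x: "x \<ge> 0"
  shows "(\<lambda>k. 1 / (real n - 1) * expectation (\<lambda>\<omega>. critical_value_sum (rand_poly n \<omega>) (cutoff x k)))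
      \<longlonglongrightarrow> critical_value_cdf n D x"
    and "integrable M (\<lambda>\<omega>. critical_value_sum (rand_poly n \<omega>) (cutoff x k))"
proof -
  have h: "has_bochner_integral M (\<lambda>\<omega>. critical_value_sum (rand_poly n \<omega>) (cutoff x k)) (LBINT y:{0..}. cutoff x k y * D y)" for k
    using D test_function_cutoff unfolding is_expected_density_def by blast
  show "integrable M (\<lambda>\<omega>. critical_value_sum (rand_poly n \<omega>) (cutoff x k))"
    using h by (simp add: has_bochner_integral_iff)
  have "expectation (\<lambda>\<omega>. critical_value_sum (rand_poly n \<omega>) (cutoff x k)) = (LBINT y:{0..}. cutoff x k y * D y)" for k
    using h by (simp add: has_bochner_integral_iff)
  moreover have "continuous_on {0..} D" using D by (simp add: is_expected_density_def)
  ultimately show "(\<lambda>k. 1 / (real n - 1) * expectation (\<lambda>\<omega>. critical_value_sum (rand_poly n \<omega>) (cutoff x k)))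
      \<longlonglongrightarrow> critical_value_cdf n D x"
    unfolding critical_value_cdf_def using x by (simp only:) (intro tendsto_mult_left set_lebesgue_integral_cutoff_tendsto)
qed

text \<open>No sign of \<open>D\<close> is assumed; nonnegativity is inherited from the
  expectations.\<close>

lemma critical_value_cdf_nonneg:
  assumes n: "n \<ge> 2" and D: "is_expected_density M a n D" and x: "x \<ge> 0"
  shows "critical_value_cdf n D x \<ge> 0"
proof (rule LIMSEQ_le_const[OF critical_value_cdf_limit_expectation(1)[OF D x]], intro exI allI impI)
  show "0 \<le> 1 / (real n - 1) * expectation (\<lambda>\<omega>. critical_value_sum (rand_poly n \<omega>) (cutoff x k))" for k
    using n critical_value_sum_cutoff_le(3)[OF n] by (intro mult_nonneg_nonneg integral_nonneg_AE) auto
qed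

text \<open>Outside \<open>B\<close> at most \<open>u\<close> critical points lie where the cutoff
  can be nonzero; on \<open>B\<close> the trivial bound n - 1 is used, and the normalisation turns
  it into \<open>prob B\<close>.\<close>

lemma critical_value_cdf_le:
  fixes u :: real
  assumes n: "n \<ge> 2" and D: "is_expected_density M a n D" and x: "x \<ge> 0" and B: "B \<in> sets M" and u: "u \<ge> 0"
    and few: "\<And>\<omega>. \<omega> \<in> space M - B \<Longrightarrow>
      card {z. poly (pderiv (rand_poly n \<omega>)) z = 0 \<and> cmod (poly (rand_poly n \<omega>) z) \<le> x + 1} \<le> u"
  shows "critical_value_cdf n D x \<le> u / (real n - 1) + prob B"
proof (rule LIMSEQ_le_const2[OF critical_value_cdf_limit_expectation(1)[OF D x]], intro exI allI impI)
  fix k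
  let ?S = "\<lambda>\<omega>. critical_value_sum (rand_poly n \<omega>) (cutoff x k)"
  have int_ind: "integrable M (\<lambda>\<omega>. (real n - 1) * indicator B \<omega>)"
    using B by (intro integrable_mult_right integrable_real_indicator) (auto simp: emeasure_eq_measure)
  have "expectation ?S \<le> expectation (\<lambda>\<omega>. u + (real n - 1) * indicator B \<omega>)"
  proof (rule integral_mono)
    fix \<omega> assume \<omega>: "\<omega> \<in> space M"
    show "?S \<omega> \<le> u + (real n - 1) * indicator B \<omega>"
      using critical_value_sum_cutoff_le(1,2)[OF n, of "\<lambda>j. a j \<omega>" x k] few[of \<omega>] u \<omega>
      by (cases "\<omega> \<in> B") auto
  qed (use critical_value_cdf_limit_expectation(2)[OF D x] int_ind in auto)
  also have "\<dots> = u + (real n - 1) * prob B"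
    using int_ind by (subst Bochner_Integration.integral_add) (simp_all add: prob_space B)
  finally have "1 / (real n - 1) * expectation ?S \<le> 1 / (real n - 1) * (u + (real n - 1) * prob B)"
    using n by (intro mult_left_mono) auto
  also have "\<dots> = u / (real n - 1) + prob B" using n by (simp add: field_simps)
  finally show "1 / (real n - 1) * expectation ?S \<le> u / (real n - 1) + prob B" .
qed

lemma critical_value_cdf_le_1:
  assumes n: "n \<ge> 2" and D: "is_expected_density M a n D" and x: "x \<ge> 0"
  shows "critical_value_cdf n D x \<le> 1"
proof (rule LIMSEQ_le_const2[OF critical_value_cdf_limit_expectation(1)[OF D x]], intro exI allI impI)
  fix k
  let ?S = "\<lambda>\<omega>. critical_value_sum (rand_poly n \<omega>) (cutoff x k)"
  have "expectation ?S \<le> expectation (\<lambda>_. real n - 1)"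
    by (rule integral_mono) (use critical_value_cdf_limit_expectation(2)[OF D x]
        critical_value_sum_cutoff_le(2)[OF n] in auto)
  then show "1 / (real n - 1) * expectation ?S \<le> 1"
    using n by (simp add: prob_space field_simps)
qed

text \<open>Complementary count: outside \<open>B\<close> all but \<open>u\<close> of the n - 1
  critical points contribute 1 each; on \<open>B\<close> the sum is only known to be
  nonnegative.\<close>

lemma critical_value_cdf_ge:
  fixes u :: real
  assumes n: "n \<ge> 2" and D: "is_expected_density M a n D" and x: "x \<ge> 0" and B: "B \<in> sets M" and u: "u \<ge> 0"
    and many: "\<And>\<omega>. \<omega> \<in> space M - B \<Longrightarrow> card {z. poly (pderiv (rand_poly n \<omega>)) z = 0} = n - 1 \<and>
      card {z. poly (pderiv (rand_poly n \<omega>)) z = 0 \<and> cmod (poly (rand_poly n \<omega>) z) > x} \<le> u"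
  shows "critical_value_cdf n D x \<ge> 1 - u / (real n - 1) - prob B"
proof (rule LIMSEQ_le_const[OF critical_value_cdf_limit_expectation(1)[OF D x]], intro exI allI impI)
  fix k
  let ?S = "\<lambda>\<omega>. critical_value_sum (rand_poly n \<omega>) (cutoff x k)"
  have int_ind: "integrable M (\<lambda>\<omega>. (real n - 1) * indicator B \<omega>)"
    using B by (intro integrable_mult_right integrable_real_indicator) (auto simp: emeasure_eq_measure)
  have "real n - 1 - u - (real n - 1) * prob B = expectation (\<lambda>\<omega>. (real n - 1 - u) - (real n - 1) * indicator B \<omega>)"
    using int_ind by (subst Bochner_Integration.integral_diff) (simp_all add: prob_space B)
  also have "\<dots> \<le> expectation ?S"
  proof (rule integral_mono)
    fix \<omega> assume \<omega>: "\<omega> \<in> space M"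
    show "(real n - 1 - u) - (real n - 1) * indicator B \<omega> \<le> ?S \<omega>"
    proof (cases "\<omega> \<in> B")
      case True
      then show ?thesis using critical_value_sum_cutoff_le(3)[OF n, of "\<lambda>j. a j \<omega>" x k] u by simp
    next
      case False
      let ?p = "rand_poly n \<omega>"
      let ?Z = "{z. poly (pderiv ?p) z = 0}"
      let ?L = "{z. poly (pderiv ?p) z = 0 \<and> cmod (poly ?p z) \<le> x}" and ?G = "{z. poly (pderiv ?p) z = 0 \<and> cmod (poly ?p z) > x}"
      have Z: "card ?Z = n - 1" "card ?G \<le> u" using many[of \<omega>] \<omega> False by auto
      \<comment> \<open>\<open>card\<close> of an infinite set is 0, so the positive count n - 1
        gives finiteness and with it a nonzero derivative.\<close>
      then have "finite ?Z" using n by (intro card_ge_0_finite) simp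
      then have nz: "pderiv ?p \<noteq> 0" using infinite_UNIV_char_0[where 'a=complex] by auto
      have Z_eq: "?Z = ?L \<union> ?G" by auto
      have "card ?Z \<le> card ?L + card ?G" by (subst Z_eq) (rule card_Un_le)
      then have "real n - 1 - u \<le> card ?L" using Z n by linarith
      also have "\<dots> \<le> ?S \<omega>" using critical_value_sum_cutoff_le(4)[OF n, of "\<lambda>j. a j \<omega>" x k] nz by simp
      finally show ?thesis using False by simp
    qed
  qed (use critical_value_cdf_limit_expectation(2)[OF D x] int_ind in auto)
  finally have "1 / (real n - 1) * (real n - 1 - u - (real n - 1) * prob B) \<le> 1 / (real n - 1) * expectation ?S"
    using n by (intro mult_left_mono) auto
  moreover have "1 / (real n - 1) * (real n - 1 - u - (real n - 1) * prob B) = 1 - u / (real n - 1) - prob B"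
    using n by (simp add: field_simps)
  ultimately show "1 - u / (real n - 1) - prob B \<le> 1 / (real n - 1) * expectation ?S" by linarith
qed

lemma critical_value_cdf_tendsto_0:
  assumes D: "\<And>n. n \<ge> 2 \<Longrightarrow> is_expected_density M a n (D n)"
    and x: "\<And>n. x n \<ge> 0" and le: "\<And>c. c > 0 \<Longrightarrow> \<forall>\<^sub>F n in sequentially. x n + 1 \<le> 2 * exp (c * real n)"
  shows "(\<lambda>n. critical_value_cdf n (D n) (x n)) \<longlonglongrightarrow> 0"
proof (rule tendstoI)
  fix e :: real assume e: "e > 0"
  \<comment> \<open>With \<tau> = e/8 the proportion \<open>2 * \<tau> * n / (n - 1)\<close> is at
    most 4 \<tau> = e/2, because n \<le> 2 (n - 1); the exceptional probability takes the other
    half.\<close>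
  then have "e / 8 > 0" by simp
  from eventually_good_event[OF this] obtain c C :: real and r :: "nat \<Rightarrow> real" where c: "c > 0" and r: "r \<longlonglongrightarrow> 0" and
    good: "\<forall>\<^sub>F n in sequentially. \<exists>B\<in>sets M. prob B \<le> r n \<and> (\<forall>\<omega>\<in>space M - B.
        card {z. poly (pderiv (rand_poly n \<omega>)) z = 0} = n - 1 \<and>
        card {z. poly (pderiv (rand_poly n \<omega>)) z = 0 \<and> cmod (poly (rand_poly n \<omega>) z) \<le> 2 * exp (c * n)} \<le> 2 * (e / 8) * n \<and>
        card {z. poly (pderiv (rand_poly n \<omega>)) z = 0 \<and> cmod (poly (rand_poly n \<omega>) z) > exp (C * n)} \<le> e / 8 * n)"
    by blast
  have "\<forall>\<^sub>F n in sequentially. r n < e / 2" using r e by (intro order_tendstoD) auto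
  then show "\<forall>\<^sub>F n in sequentially. dist (critical_value_cdf n (D n) (x n)) 0 < e"
    using good le[OF c] eventually_ge_at_top[of "2 :: nat"]
  proof eventually_elim
    case (elim n)
    then obtain B where B: "B \<in> sets M" "prob B \<le> r n" and few: "\<And>\<omega>. \<omega> \<in> space M - B \<Longrightarrow>
        card {z. poly (pderiv (rand_poly n \<omega>)) z = 0} = n - 1 \<and>
        card {z. poly (pderiv (rand_poly n \<omega>)) z = 0 \<and> cmod (poly (rand_poly n \<omega>) z) \<le> 2 * exp (c * n)} \<le> 2 * (e / 8) * n"
      by blast
    have n: "n \<ge> 2" by fact
    have "critical_value_cdf n (D n) (x n) \<le> (2 * (e / 8) * n) / (real n - 1) + prob B"
    proof (rule critical_value_cdf_le[OF n D[OF n] x B(1)])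
      fix \<omega> assume \<omega>: "\<omega> \<in> space M - B"
      let ?p = "rand_poly n \<omega>"
      have "finite {z. poly (pderiv ?p) z = 0}"
        using few[OF \<omega>] n by (intro card_ge_0_finite) auto
      then have "card {z. poly (pderiv ?p) z = 0 \<and> cmod (poly ?p z) \<le> x n + 1}
          \<le> card {z. poly (pderiv ?p) z = 0 \<and> cmod (poly ?p z) \<le> 2 * exp (c * n)}"
        using elim(3) by (intro card_mono) (auto intro: rev_finite_subset)
      then show "card {z. poly (pderiv ?p) z = 0 \<and> cmod (poly ?p z) \<le> x n + 1} \<le> 2 * (e / 8) * n"
        using few[OF \<omega>] by linarith
    qed (use e in simp)
    moreover have "(2 * (e / 8) * n) / (real n - 1) \<le> e / 2"
      using n e by (simp add: field_simps)
    ultimately have "critical_value_cdf n (D n) (x n) < e" using B elim(1) by linarith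
    then show ?case using critical_value_cdf_nonneg[OF n D[OF n] x[of n]] by (simp add: dist_real_def)
  qed
qed

lemma critical_value_cdf_tendsto_1:
  assumes D: "\<And>n. n \<ge> 2 \<Longrightarrow> is_expected_density M a n (D n)"
    and x: "\<And>n. x n \<ge> 0" and ge: "\<And>C. \<forall>\<^sub>F n in sequentially. exp (C * real n) \<le> x n"
  shows "(\<lambda>n. critical_value_cdf n (D n) (x n)) \<longlonglongrightarrow> 1"
proof (rule tendstoI)
  fix e :: real assume e: "e > 0"
  \<comment> \<open>Only the region beyond the outer circle is lost here, so the proportion is at
    most 2 \<tau> = e/4.\<close>
  then have "e / 8 > 0" by simp
  from eventually_good_event[OF this] obtain c C :: real and r :: "nat \<Rightarrow> real" where r: "r \<longlonglongrightarrow> 0" and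
    good: "\<forall>\<^sub>F n in sequentially. \<exists>B\<in>sets M. prob B \<le> r n \<and> (\<forall>\<omega>\<in>space M - B.
        card {z. poly (pderiv (rand_poly n \<omega>)) z = 0} = n - 1 \<and>
        card {z. poly (pderiv (rand_poly n \<omega>)) z = 0 \<and> cmod (poly (rand_poly n \<omega>) z) \<le> 2 * exp (c * n)} \<le> 2 * (e / 8) * n \<and>
        card {z. poly (pderiv (rand_poly n \<omega>)) z = 0 \<and> cmod (poly (rand_poly n \<omega>) z) > exp (C * n)} \<le> e / 8 * n)"
    by blast
  have "\<forall>\<^sub>F n in sequentially. r n < e / 2" using r e by (intro order_tendstoD) auto
  then show "\<forall>\<^sub>F n in sequentially. dist (critical_value_cdf n (D n) (x n)) 1 < e"
    using good ge[of C] eventually_ge_at_top[of "2 :: nat"]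
  proof eventually_elim
    case (elim n)
    then obtain B where B: "B \<in> sets M" "prob B \<le> r n" and few: "\<And>\<omega>. \<omega> \<in> space M - B \<Longrightarrow>
        card {z. poly (pderiv (rand_poly n \<omega>)) z = 0} = n - 1 \<and>
        card {z. poly (pderiv (rand_poly n \<omega>)) z = 0 \<and> cmod (poly (rand_poly n \<omega>) z) > exp (C * n)} \<le> e / 8 * n"
      by blast
    have n: "n \<ge> 2" by fact
    have "critical_value_cdf n (D n) (x n) \<ge> 1 - (e / 8 * n) / (real n - 1) - prob B"
    proof (rule critical_value_cdf_ge[OF n D[OF n] x B(1)])
      fix \<omega> assume \<omega>: "\<omega> \<in> space M - B"
      let ?p = "rand_poly n \<omega>"
      have "finite {z. poly (pderiv ?p) z = 0}"
        using few[OF \<omega>] n by (intro card_ge_0_finite) auto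
      then have "card {z. poly (pderiv ?p) z = 0 \<and> cmod (poly ?p z) > x n}
          \<le> card {z. poly (pderiv ?p) z = 0 \<and> cmod (poly ?p z) > exp (C * n)}"
        using elim(3) by (intro card_mono) (auto intro: rev_finite_subset)
      then show "card {z. poly (pderiv ?p) z = 0} = n - 1 \<and>
          card {z. poly (pderiv ?p) z = 0 \<and> cmod (poly ?p z) > x n} \<le> e / 8 * n"
        using few[OF \<omega>] by linarith
    qed (use e in simp)
    moreover have "(e / 8 * n) / (real n - 1) \<le> e / 4"
      using n e by (simp add: field_simps)
    ultimately have "critical_value_cdf n (D n) (x n) > 1 - e" using B elim(1) e by linarith
    then show ?case using critical_value_cdf_le_1[OF n D[OF n] x[of n]] by (simp add: dist_real_def)
  qed
qed

end

theorem theorem3: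
  fixes M :: "'a measure" and a :: "nat \<Rightarrow> 'a \<Rightarrow> complex"
    and D :: "nat \<Rightarrow> real \<Rightarrow> real" and \<epsilon> :: real
  assumes "prob_space M"
    and "prob_space.indep_vars M (\<lambda>_. borel) a UNIV"
    and "\<And>j. distributed M lborel (a j) (\<lambda>z. ennreal (1 / pi * exp (- (cmod z)\<^sup>2)))"
    and "\<And>n. n \<ge> 2 \<Longrightarrow> is_expected_density M a n (D n)"
    and "\<epsilon> > 0"
  shows "((\<lambda>n. critical_value_cdf n (D n) (exp (real n powr (1 - \<epsilon>) / 2))) \<longlonglongrightarrow> 0) \<and>
         ((\<lambda>n. critical_value_cdf n (D n) (exp (real n powr (1 + \<epsilon>) / 2))) \<longlonglongrightarrow> 1)"
proof
  interpret gaussian_coeffs M a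
    using assms(1-3) by (intro gaussian_coeffs.intro gaussian_coeffs_axioms.intro)
  show "(\<lambda>n. critical_value_cdf n (D n) (exp (real n powr (1 - \<epsilon>) / 2))) \<longlonglongrightarrow> 0"
  proof (rule critical_value_cdf_tendsto_0[OF assms(4)])
    fix c :: real assume c: "c > 0"
    \<comment> \<open>Factoring n^(1-\<epsilon>) as n * n^(-\<epsilon>) also covers \<epsilon> \<ge>
      1, where the exponent is no longer positive.\<close>
    have "((\<lambda>n. real n powr (- \<epsilon>)) \<longlongrightarrow> 0) sequentially" using assms(5) by real_asymp
    then have "\<forall>\<^sub>F n in sequentially. real n powr (- \<epsilon>) < 2 * c" using c by (intro order_tendstoD) auto
    then show "\<forall>\<^sub>F n in sequentially. exp (real n powr (1 - \<epsilon>) / 2) + 1 \<le> 2 * exp (c * real n)"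
      using eventually_gt_at_top[of 0]
    proof eventually_elim
      case (elim n)
      have "real n powr (1 - \<epsilon>) = real n powr (1 + (- \<epsilon>))" by simp
      also have "\<dots> = real n * real n powr (- \<epsilon>)" using elim(2) by (subst powr_add) simp
      also have "\<dots> \<le> real n * (2 * c)" using elim(1) by (intro mult_left_mono) auto
      finally have "exp (real n powr (1 - \<epsilon>) / 2) \<le> exp (c * real n)" by (simp add: mult_ac)
      \<comment> \<open>The 1 added for the cutoff is absorbed by the second copy of
        \<open>exp (c * real n)\<close>.\<close>
      moreover have "1 \<le> exp (c * real n)" using c by simp
      ultimately show ?case by linarith
    qed
  qed auto
  show "(\<lambda>n. critical_value_cdf n (D n) (exp (real n powr (1 + \<epsilon>) / 2))) \<longlonglongrightarrow> 1"
  proof (rule critical_value_cdf_tendsto_1[OF assms(4)])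
    fix C :: real
    have "filterlim (\<lambda>n. real n powr \<epsilon>) at_top sequentially" using assms(5) by real_asymp
    then have "\<forall>\<^sub>F n in sequentially. real n powr \<epsilon> \<ge> 2 * C" by (simp add: filterlim_at_top)
    then show "\<forall>\<^sub>F n in sequentially. exp (C * real n) \<le> exp (real n powr (1 + \<epsilon>) / 2)"
      using eventually_gt_at_top[of 0]
    proof eventually_elim
      case (elim n)
      have "real n * (2 * C) \<le> real n * real n powr \<epsilon>" using elim(1) by (intro mult_left_mono) auto
      also have "\<dots> = real n powr (1 + \<epsilon>)" using elim(2) by (subst powr_add) simp
      finally show ?case by (simp add: mult_ac)
    qed
  qed auto
qed

end
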